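(* Let $T>0$ and let $X=(X_t)_{t\in[0,T]}$ be a real-valued càdlàg process with independent increments (PII). Then $X$ satisfies a co-monotony principle on $(\mathbb{D}([0,T],\mathbb{R}),\|\cdot\|_{\sup})$.
   Context: A process with independent increments (PII) is a process such that $X_t-X_s$ is independent of $\sigma(X_u,\,u\le s)$ for all $s\le t$ (increments are not assumed stationary and fixed times of discontinuity are allowed). $\mathbb{D}([0,T],\mathbb{R})$ is the space of càdlàg functions on $[0,T]$, with the $\sigma$-field generated by the evaluations $\alpha\mapsto\alpha(t)$, the sup-norm $\|\alpha\|_{\sup}=\sup_{t\in[0,T]}|\alpha(t)|$, and the pointwise order ($\alpha\le\beta$ if $\alpha(t)\le\beta(t)$ for all $t\in[0,T]$). Two measurable functionals are co-monotone if they are both non-decreasing or both non-increasing for this order. $X$ satisfies a co-monotony principle on $(\mathbb{D}([0,T],\mathbb{R}),\|\cdot\|_{\sup})$ if $\mathbb{E}\,F(X)G(X)\ge\mathbb{E}\,F(X)\,\mathbb{E}\,G(X)$ for every pair of bounded, co-monotone, measurable functionals $F,G:\mathbb{D}([0,T],\mathbb{R})\to\mathbb{R}$ that are $\mathbb{P}_X$-a.s. continuous for the sup-norm (continuous at every point of a set of probability $1$ under the distribution $\mathbb{P}_X$ of $X$). *)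

theory Defs
  imports "HOL-Probability.Probability"
begin

definition cadlag_on :: "real \<Rightarrow> (real \<Rightarrow> real) \<Rightarrow> bool" where
  "cadlag_on T \<alpha> \<longleftrightarrow>
     (\<forall>t. 0 \<le> t \<and> t < T \<longrightarrow> (\<alpha> \<longlongrightarrow> \<alpha> t) (at_right t)) \<and>
     (\<forall>t. 0 < t \<and> t \<le> T \<longrightarrow> (\<exists>l. (\<alpha> \<longlongrightarrow> l) (at_left t)))"

text \<open>
  A function on \<open>[0,T]\<close> is represented by the unique HOL function that agrees with it on \<open>{0..T}\<close>
  and is \<^const>\<open>undefined\<close> elsewhere, so that equality of elements is equality on \<open>[0,T]\<close>.
\<close>
definition cadlag_space :: "real \<Rightarrow> (real \<Rightarrow> real) set" where
  "cadlag_space T = {\<alpha> \<in> extensional {0..T}. cadlag_on T \<alpha>}"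

definition cadlag_algebra :: "real \<Rightarrow> (real \<Rightarrow> real) measure" where
  "cadlag_algebra T =
     sigma (cadlag_space T) {{\<alpha> \<in> cadlag_space T. \<alpha> t \<in> B} | t B. t \<in> {0..T} \<and> B \<in> sets borel}"

definition sup_norm :: "real \<Rightarrow> (real \<Rightarrow> real) \<Rightarrow> real" where
  "sup_norm T \<alpha> = (SUP t\<in>{0..T}. \<bar>\<alpha> t\<bar>)"

definition path_le :: "real \<Rightarrow> (real \<Rightarrow> real) \<Rightarrow> (real \<Rightarrow> real) \<Rightarrow> bool" where
  "path_le T \<alpha> \<beta> \<longleftrightarrow> (\<forall>t\<in>{0..T}. \<alpha> t \<le> \<beta> t)"

definition comonotone :: "real \<Rightarrow> ((real \<Rightarrow> real) \<Rightarrow> real) \<Rightarrow> ((real \<Rightarrow> real) \<Rightarrow> real) \<Rightarrow> bool" where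
  "comonotone T F G \<longleftrightarrow>
     (monotone_on (cadlag_space T) (path_le T) (\<le>) F \<and> monotone_on (cadlag_space T) (path_le T) (\<le>) G) \<or>
     (monotone_on (cadlag_space T) (path_le T) (\<ge>) F \<and> monotone_on (cadlag_space T) (path_le T) (\<ge>) G)"

definition sup_continuous_at :: "real \<Rightarrow> ((real \<Rightarrow> real) \<Rightarrow> real) \<Rightarrow> (real \<Rightarrow> real) \<Rightarrow> bool" where
  "sup_continuous_at T F \<alpha> \<longleftrightarrow>
     (\<forall>\<epsilon>>0. \<exists>\<delta>>0. \<forall>\<beta>\<in>cadlag_space T.
        sup_norm T (\<lambda>t. \<beta> t - \<alpha> t) < \<delta> \<longrightarrow> \<bar>F \<beta> - F \<alpha>\<bar> < \<epsilon>)"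

definition cadlag_process :: "'a measure \<Rightarrow> real \<Rightarrow> (real \<Rightarrow> 'a \<Rightarrow> real) \<Rightarrow> bool" where
  "cadlag_process M T X \<longleftrightarrow>
     (\<forall>t\<in>{0..T}. X t \<in> borel_measurable M) \<and> (\<forall>\<omega>\<in>space M. cadlag_on T (\<lambda>t. X t \<omega>))"

text \<open>The initial value \<open>X 0\<close> may be random.\<close>
definition independent_increments :: "'a measure \<Rightarrow> real \<Rightarrow> (real \<Rightarrow> 'a \<Rightarrow> real) \<Rightarrow> bool" where
  "independent_increments M T X \<longleftrightarrow>
     (\<forall>s t. 0 \<le> s \<and> s \<le> t \<and> t \<le> T \<longrightarrow>
        prob_space.indep_set M
          (sets (vimage_algebra (space M) (\<lambda>\<omega>. X t \<omega> - X s \<omega>) borel))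
          (sigma_sets (space M) (\<Union>u\<in>{0..s}. sets (vimage_algebra (space M) (X u) borel))))"

definition sample_path :: "real \<Rightarrow> (real \<Rightarrow> 'a \<Rightarrow> real) \<Rightarrow> 'a \<Rightarrow> (real \<Rightarrow> real)" where
  "sample_path T X \<omega> = (\<lambda>t\<in>{0..T}. X t \<omega>)"

definition path_distr :: "'a measure \<Rightarrow> real \<Rightarrow> (real \<Rightarrow> 'a \<Rightarrow> real) \<Rightarrow> (real \<Rightarrow> real) measure" where
  "path_distr M T X = distr M (cadlag_algebra T) (sample_path T X)"

definition comonotony_principle :: "'a measure \<Rightarrow> real \<Rightarrow> (real \<Rightarrow> 'a \<Rightarrow> real) \<Rightarrow> bool" where
  "comonotony_principle M T X \<longleftrightarrow>
     (\<forall>F G. F \<in> borel_measurable (cadlag_algebra T) \<and> G \<in> borel_measurable (cadlag_algebra T) \<and>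
        bounded (F ` cadlag_space T) \<and> bounded (G ` cadlag_space T) \<and>
        comonotone T F G \<and>
        (AE \<alpha> in path_distr M T X. sup_continuous_at T F \<alpha>) \<and>
        (AE \<alpha> in path_distr M T X. sup_continuous_at T G \<alpha>) \<longrightarrow>
        (\<integral>\<omega>. F (sample_path T X \<omega>) * G (sample_path T X \<omega>) \<partial>M) \<ge>
          (\<integral>\<omega>. F (sample_path T X \<omega>) \<partial>M) * (\<integral>\<omega>. G (sample_path T X \<omega>) \<partial>M))"

lemma cadlag_on_cong:
  assumes "\<And>t. t \<in> {0..T} \<Longrightarrow> \<alpha> t = \<beta> t" and "cadlag_on T \<alpha>"
  shows "cadlag_on T \<beta>"
proof -
  have r: "eventually (\<lambda>x. \<alpha> x = \<beta> x) (at_right t)" if "0 \<le> t" "t < T" for t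
    unfolding eventually_at_right[OF \<open>t < T\<close>] using assms(1) that by (intro exI[of _ T]) auto
  have l: "eventually (\<lambda>x. \<alpha> x = \<beta> x) (at_left t)" if "0 < t" "t \<le> T" for t
    unfolding eventually_at_left[OF \<open>0 < t\<close>] using assms(1) that by (intro exI[of _ 0]) auto
  show ?thesis
    unfolding cadlag_on_def
  proof (intro conjI allI impI)
    fix t assume t: "0 \<le> t \<and> t < T"
    then have "(\<alpha> \<longlongrightarrow> \<beta> t) (at_right t)"
      using assms by (auto simp: cadlag_on_def)
    then show "(\<beta> \<longlongrightarrow> \<beta> t) (at_right t)"
      using tendsto_cong[OF r[of t]] t by auto
  next
    fix t assume t: "0 < t \<and> t \<le> T"
    then obtain x where "(\<alpha> \<longlongrightarrow> x) (at_left t)"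
      using assms by (auto simp: cadlag_on_def)
    then show "\<exists>x. (\<beta> \<longlongrightarrow> x) (at_left t)"
      using tendsto_cong[OF l[of t]] t by auto
  qed
qed

lemma sample_path_measurable:
  assumes "cadlag_process M T X"
  shows "sample_path T X \<in> measurable M (cadlag_algebra T)"
  unfolding cadlag_algebra_def
proof (rule measurable_measure_of)
  show "{{\<alpha> \<in> cadlag_space T. \<alpha> t \<in> B} |t B. t \<in> {0..T} \<and> B \<in> sets borel} \<subseteq> Pow (cadlag_space T)"
    by auto
  show sp: "sample_path T X \<in> space M \<rightarrow> cadlag_space T"
  proof
    fix \<omega> assume "\<omega> \<in> space M"
    then have "cadlag_on T (\<lambda>t. X t \<omega>)" using assms by (auto simp: cadlag_process_def)
    then have "cadlag_on T (sample_path T X \<omega>)"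
      by (rule cadlag_on_cong[rotated]) (auto simp: sample_path_def)
    then show "sample_path T X \<omega> \<in> cadlag_space T" by (auto simp: cadlag_space_def sample_path_def)
  qed
  fix A assume "A \<in> {{\<alpha> \<in> cadlag_space T. \<alpha> t \<in> B} |t B. t \<in> {0..T} \<and> B \<in> sets borel}"
  then obtain t B where A: "A = {\<alpha> \<in> cadlag_space T. \<alpha> t \<in> B}" "t \<in> {0..T}" "B \<in> sets borel" by blast
  then have "sample_path T X -` A \<inter> space M = X t -` B \<inter> space M"
    using sp by (auto simp: sample_path_def Pi_iff)
  also have "\<dots> \<in> sets M"
    using assms A by (intro measurable_sets[of _ _ borel]) (auto simp: cadlag_process_def)
  finally show "sample_path T X -` A \<inter> space M \<in> sets M" .
qed

text \<open>Hence the supremum in \<^const>\<open>sup_norm\<close> is over a bounded set.\<close>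
lemma cadlag_on_bounded:
  assumes "cadlag_on T \<alpha>"
  shows "bounded (\<alpha> ` {0..T})"
proof -
  have side: "\<exists>C. eventually (\<lambda>x. \<bar>\<alpha> x\<bar> \<le> C) F" if "(\<alpha> \<longlongrightarrow> l) F" for l F
  proof -
    have "eventually (\<lambda>x. dist (\<alpha> x) l < 1) F" using that by (rule tendstoD) simp
    then have "eventually (\<lambda>x. \<bar>\<alpha> x\<bar> \<le> \<bar>l\<bar> + 1) F"
      by (rule eventually_mono) (auto simp: dist_real_def)
    then show ?thesis by blast
  qed
  have loc: "\<exists>U C. open U \<and> t \<in> U \<and> (\<forall>x\<in>U \<inter> {0..T}. \<bar>\<alpha> x\<bar> \<le> C)" if t: "t \<in> {0..T}" for t
  proof -
    obtain R where R: "eventually (\<lambda>x. x \<in> {0..T} \<longrightarrow> \<bar>\<alpha> x\<bar> \<le> R) (at_right t)"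
    proof (cases "t < T")
      case True
      then have "(\<alpha> \<longlongrightarrow> \<alpha> t) (at_right t)" using assms t by (auto simp: cadlag_on_def)
      from side[OF this] show ?thesis using that by (metis (mono_tags, lifting) eventually_mono)
    next
      case False
      then have "eventually (\<lambda>x. x \<in> {0..T} \<longrightarrow> \<bar>\<alpha> x\<bar> \<le> 0) (at_right t)"
        using t by (auto simp: eventually_at_right_field intro!: exI[of _ "t + 1"])
      then show ?thesis using that by blast
    qed
    obtain L where L: "eventually (\<lambda>x. x \<in> {0..T} \<longrightarrow> \<bar>\<alpha> x\<bar> \<le> L) (at_left t)"
    proof (cases "0 < t")
      case True
      then obtain l where "(\<alpha> \<longlongrightarrow> l) (at_left t)" using assms t by (auto simp: cadlag_on_def)
      from side[OF this] show ?thesis using that by (metis (mono_tags, lifting) eventually_mono)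
    next
      case False
      then have "eventually (\<lambda>x. x \<in> {0..T} \<longrightarrow> \<bar>\<alpha> x\<bar> \<le> 0) (at_left t)"
        using t by (auto simp: eventually_at_left_field intro!: exI[of _ "t - 1"])
      then show ?thesis using that by blast
    qed
    define C where "C = max (max R L) \<bar>\<alpha> t\<bar>"
    have "eventually (\<lambda>x. x \<in> {0..T} \<longrightarrow> \<bar>\<alpha> x\<bar> \<le> C) (at t)"
      unfolding eventually_at_split
      using R L by (auto simp: C_def elim!: eventually_mono)
    then obtain U where "open U" "t \<in> U" "\<forall>x\<in>U. x \<noteq> t \<longrightarrow> x \<in> {0..T} \<longrightarrow> \<bar>\<alpha> x\<bar> \<le> C"
      unfolding eventually_at_topological by auto
    then show ?thesis by (intro exI[of _ U] exI[of _ C]) (auto simp: C_def)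
  qed
  then obtain U C where UC:
    "\<And>t. t \<in> {0..T} \<Longrightarrow> open (U t) \<and> t \<in> U t \<and> (\<forall>x\<in>U t \<inter> {0..T}. \<bar>\<alpha> x\<bar> \<le> C t)"
    by metis
  obtain I where I: "I \<subseteq> {0..T}" "finite I" "{0..T} \<subseteq> (\<Union>t\<in>I. U t)"
    by (rule compactE_image[OF compact_Icc[of 0 T], of "{0..T}" U]) (use UC in auto)
  have "bounded (\<alpha> ` (U t \<inter> {0..T}))" if "t \<in> I" for t
    unfolding bounded_iff using UC[of t] I that by (intro exI[of _ "C t"]) auto
  then have "bounded (\<Union>t\<in>I. \<alpha> ` (U t \<inter> {0..T}))" using I by auto
  then show ?thesis by (rule bounded_subset) (use I in blast)
qed

end

theory Submission imports Defs begin

text \<open>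
  Call a measure on an ordered space associated if bounded non-decreasing functions are non-negatively
  correlated under it. Measures on linear orders are associated (Chebyshev), and association passes
  to products and to monotone images; since \<open>X b = X a + (X b - X a)\<close> with an independent increment,
  all finite-dimensional distributions of \<open>X\<close> are associated.

  The passage to functionals of the whole path does not go through step approximations, which need not
  converge in the sup-norm. A cadlag path is instead coded by its values at countably many dense times
  \<open>e 0, e 1, \<dots>\<close>, and the codes range over a Borel set of real sequences. An increasing event is
  approximated from inside by compact sets \<open>K\<close>; the upward closure of a compact \<open>K\<close> is the decreasing
  intersection of the closed cylinders \<open>{x. \<exists>y\<in>K. \<forall>i\<le>n. y i \<le> x i}\<close>, which are increasing events
  depending on finitely many times. Thus increasing events are positively correlated, and bounded
  monotone functionals follow by decomposing them into superlevel sets.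
\<close>

section \<open>Association\<close>

definition associated :: "'b::order measure \<Rightarrow> bool" where
  "associated N \<longleftrightarrow>
     (\<forall>f g :: 'b \<Rightarrow> real. f \<in> borel_measurable N \<and> g \<in> borel_measurable N \<and> mono f \<and> mono g \<and>
        bounded (range f) \<and> bounded (range g) \<longrightarrow>
        (\<integral>x. f x \<partial>N) * (\<integral>x. g x \<partial>N) \<le> (\<integral>x. f x * g x \<partial>N))"

lemma associatedD:
  fixes f g :: "'b::order \<Rightarrow> real"
  assumes "associated N" "f \<in> borel_measurable N" "g \<in> borel_measurable N" "mono f" "mono g"
    "bounded (range f)" "bounded (range g)"
  shows "(\<integral>x. f x \<partial>N) * (\<integral>x. g x \<partial>N) \<le> (\<integral>x. f x * g x \<partial>N)"
  using assms unfolding associated_def by blast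

lemma bounded_range_times:
  fixes f g :: "'b \<Rightarrow> real"
  assumes "bounded (range f)" "bounded (range g)"
  shows "bounded (range (\<lambda>x. f x * g x))"
proof -
  obtain A B where "\<And>x. \<bar>f x\<bar> \<le> A" "\<And>x. \<bar>g x\<bar> \<le> B"
    using assms by (auto simp: bounded_iff)
  then have "\<bar>f x * g x\<bar> \<le> A * B" for x
    unfolding abs_mult by (intro mult_mono') auto
  then show ?thesis by (auto simp: bounded_iff)
qed

lemma (in prob_space) integrable_bounded_range:
  fixes f :: "'a \<Rightarrow> real"
  assumes "f \<in> borel_measurable M" "bounded (range f)"
  shows "integrable M f"
proof -
  obtain A where "\<And>x. \<bar>f x\<bar> \<le> A"
    using assms by (auto simp: bounded_iff)
  then show ?thesis using assms by (intro integrable_const_bound[where B=A]) auto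
qed

text \<open>Chebyshev's trick with two independent copies \<open>x\<close> and \<open>y\<close>:
  totality of the order makes \<open>(f x - f y) * (g x - g y)\<close> non-negative, and its double
  integral is twice the covariance. Integrating over \<open>x\<close> first and then over
  \<open>y\<close> needs only single integrals.\<close>

lemma associated_linorder:
  fixes N :: "'b::linorder measure"
  assumes "prob_space N"
  shows "associated N"
  unfolding associated_def
proof (intro allI impI)
  fix f g :: "'b \<Rightarrow> real"
  assume *: "f \<in> borel_measurable N \<and> g \<in> borel_measurable N \<and> mono f \<and> mono g \<and>
        bounded (range f) \<and> bounded (range g)"
  interpret prob_space N by fact
  have [simp]: "integrable N f" "integrable N g" "integrable N (\<lambda>x. f x * g x)"
    using * by (auto intro!: integrable_bounded_range bounded_range_times)
  let ?f = "\<integral>x. f x \<partial>N" and ?g = "\<integral>x. g x \<partial>N" and ?fg = "\<integral>x. f x * g x \<partial>N"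
  have pos: "0 \<le> ?fg - f y * ?g - g y * ?f + f y * g y" for y
  proof -
    have "0 \<le> (f x - f y) * (g x - g y)" for x
      using * by (cases x y rule: linorder_cases)
        (auto simp: zero_le_mult_iff dest!: monoD[of f] monoD[of g] less_imp_le)
    then have "0 \<le> (\<integral>x. (f x - f y) * (g x - g y) \<partial>N)"
      by (intro integral_nonneg_AE) auto
    also have "\<dots> = (\<integral>x. f x * g x - f y * g x - g y * f x + f y * g y \<partial>N)"
      by (simp add: algebra_simps)
    also have "\<dots> = ?fg - f y * ?g - g y * ?f + f y * g y"
      using * by (simp add: prob_space)
    finally show ?thesis .
  qed
  have "0 \<le> (\<integral>y. ?fg - f y * ?g - g y * ?f + f y * g y \<partial>N)"
    using pos by (intro integral_nonneg_AE) auto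
  also have "\<dots> = 2 * (?fg - ?f * ?g)"
    using * by (simp add: prob_space algebra_simps)
  finally show "?f * ?g \<le> ?fg" by simp
qed

lemma associated_distr:
  assumes "associated N" "h \<in> measurable N K" "mono h"
  shows "associated (distr N K h)"
  unfolding associated_def
proof (intro allI impI)
  fix f g :: "_ \<Rightarrow> real"
  assume *: "f \<in> borel_measurable (distr N K h) \<and> g \<in> borel_measurable (distr N K h) \<and>
        mono f \<and> mono g \<and> bounded (range f) \<and> bounded (range g)"
  have "(\<integral>x. f (h x) \<partial>N) * (\<integral>x. g (h x) \<partial>N) \<le> (\<integral>x. f (h x) * g (h x) \<partial>N)"
    using * assms
    by (intro associatedD) (auto intro!: monoI dest: monoD intro: bounded_subset)
  then show "(\<integral>x. f x \<partial>distr N K h) * (\<integral>x. g x \<partial>distr N K h) \<le> (\<integral>x. f x * g x \<partial>distr N K h)"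
    using * assms(2) by (simp add: integral_distr borel_measurable_times)
qed

text \<open>Condition on the first coordinate: association of \<open>N2\<close> bounds each section,
  and association of \<open>N1\<close> applies to the partial integrals, which inherit monotonicity
  and boundedness. The sections are used at every \<open>x\<close> of the type, hence
  \<open>space N1 = UNIV\<close>.\<close>

lemma associated_distr_pair:
  assumes "prob_space N1" "associated N1" "prob_space N2" "associated N2"
    and [simp]: "space N1 = UNIV"
    and h: "h \<in> measurable (N1 \<Otimes>\<^sub>M N2) K" "\<And>x x' y y'. x \<le> x' \<Longrightarrow> y \<le> y' \<Longrightarrow> h (x, y) \<le> h (x', y')"
  shows "associated (distr (N1 \<Otimes>\<^sub>M N2) K h)"
  unfolding associated_def
proof (intro allI impI)
  interpret N1: prob_space N1 by fact
  interpret N2: prob_space N2 by fact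
  interpret pair_prob_space N1 N2 ..
  fix f g :: "_ \<Rightarrow> real"
  assume "f \<in> borel_measurable (distr (N1 \<Otimes>\<^sub>M N2) K h) \<and> g \<in> borel_measurable (distr (N1 \<Otimes>\<^sub>M N2) K h) \<and>
        mono f \<and> mono g \<and> bounded (range f) \<and> bounded (range g)"
  then have f: "f \<in> borel_measurable K" "mono f" "bounded (range f)"
    and g: "g \<in> borel_measurable K" "mono g" "bounded (range g)" by auto
  have Fub: "(\<integral>z. u (h z) \<partial>(N1 \<Otimes>\<^sub>M N2)) = (\<integral>x. \<integral>y. u (h (x, y)) \<partial>N2 \<partial>N1)"
    if "u \<in> borel_measurable K" "bounded (range u)" for u :: "_ \<Rightarrow> real"
    using that h
    by (intro integral_fst'[symmetric] P.integrable_bounded_range) (auto intro: bounded_subset)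
  have sect: "(\<lambda>y. u (h (x, y))) \<in> borel_measurable N2"
    if "u \<in> borel_measurable K" for u :: "_ \<Rightarrow> real" and x
    using that h by (intro measurable_compose[OF _ that] measurable_compose[OF measurable_Pair1' h(1)]) auto
  have prt: "mono (\<lambda>x. \<integral>y. u (h (x, y)) \<partial>N2)" "(\<lambda>x. \<integral>y. u (h (x, y)) \<partial>N2) \<in> borel_measurable N1"
    "bounded (range (\<lambda>x. \<integral>y. u (h (x, y)) \<partial>N2))"
    if u: "u \<in> borel_measurable K" "mono u" "bounded (range u)" for u :: "_ \<Rightarrow> real"
  proof -
    have int: "integrable N2 (\<lambda>y. u (h (x, y)))" for x
      using u sect by (intro N2.integrable_bounded_range) (auto intro: bounded_subset)
    show "mono (\<lambda>x. \<integral>y. u (h (x, y)) \<partial>N2)"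
      using h(2) by (intro monoI integral_mono int) (auto intro!: monoD[OF u(2)])
    have [measurable]: "(\<lambda>z. u (h z)) \<in> borel_measurable (N1 \<Otimes>\<^sub>M N2)" using u h by auto
    show "(\<lambda>x. \<integral>y. u (h (x, y)) \<partial>N2) \<in> borel_measurable N1"
      by measurable
    obtain B where B: "\<And>x. \<bar>u x\<bar> \<le> B" using u by (auto simp: bounded_iff)
    have "\<bar>\<integral>y. u (h (x, y)) \<partial>N2\<bar> \<le> B" for x
    proof -
      have "\<bar>\<integral>y. u (h (x, y)) \<partial>N2\<bar> \<le> (\<integral>y. \<bar>u (h (x, y))\<bar> \<partial>N2)" by (rule integral_abs_bound)
      also have "\<dots> \<le> (\<integral>y. B \<partial>N2)" using B int by (intro integral_mono) auto
      finally show ?thesis by (simp add: N2.prob_space)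
    qed
    then show "bounded (range (\<lambda>x. \<integral>y. u (h (x, y)) \<partial>N2))" by (auto simp: bounded_iff)
  qed
  have fg: "(\<lambda>x. f x * g x) \<in> borel_measurable K" "bounded (range (\<lambda>x. f x * g x))"
    using f g by (auto intro: bounded_range_times)
  have "(\<integral>x. (\<integral>y. f (h (x, y)) \<partial>N2) \<partial>N1) * (\<integral>x. (\<integral>y. g (h (x, y)) \<partial>N2) \<partial>N1)
      \<le> (\<integral>x. (\<integral>y. f (h (x, y)) \<partial>N2) * (\<integral>y. g (h (x, y)) \<partial>N2) \<partial>N1)"
    by (intro associatedD[OF assms(2)] prt f g)
  also have "\<dots> \<le> (\<integral>x. (\<integral>y. f (h (x, y)) * g (h (x, y)) \<partial>N2) \<partial>N1)"
  proof (rule integral_mono)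
    show "integrable N1 (\<lambda>x. (\<integral>y. f (h (x, y)) \<partial>N2) * (\<integral>y. g (h (x, y)) \<partial>N2))"
      by (intro N1.integrable_bounded_range bounded_range_times borel_measurable_times prt f g)
    show "integrable N1 (\<lambda>x. \<integral>y. f (h (x, y)) * g (h (x, y)) \<partial>N2)"
      using fg h by (intro integrable_fst' P.integrable_bounded_range) (auto intro: bounded_subset)
    show "(\<integral>y. f (h (x, y)) \<partial>N2) * (\<integral>y. g (h (x, y)) \<partial>N2) \<le> (\<integral>y. f (h (x, y)) * g (h (x, y)) \<partial>N2)" for x
      using f g h(2)
      by (intro associatedD[OF assms(4)] sect)
        (auto intro!: monoI monoD[OF f(2)] monoD[OF g(2)] intro: bounded_subset)
  qed
  finally show "(\<integral>x. f x \<partial>distr (N1 \<Otimes>\<^sub>M N2) K h) * (\<integral>x. g x \<partial>distr (N1 \<Otimes>\<^sub>M N2) K h)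
      \<le> (\<integral>x. f x * g x \<partial>distr (N1 \<Otimes>\<^sub>M N2) K h)"
    using Fub[OF f(1,3)] Fub[OF g(1,3)] Fub[OF fg] f g fg h by (simp add: integral_distr borel_measurable_times)
qed

section \<open>Finite-dimensional distributions\<close>

text \<open>Borel sets of sequences are generated by the coordinates, so the whole family of values
  at times up to \<open>s\<close> is measurable for the past sigma-field and jointly independent of
  the increment. Agreement on rectangles then identifies the product measure.\<close>

lemma independent_increments_distr_pair:
  fixes X :: "real \<Rightarrow> 'a \<Rightarrow> real" and e :: "nat \<Rightarrow> real"
  assumes M: "prob_space M" and X: "cadlag_process M T X" and I: "independent_increments M T X"
    and e: "range e \<subseteq> {0..s}" and s: "0 \<le> s" "s \<le> t" "t \<le> T"
  shows "distr M borel (\<lambda>\<omega> n. X (e n) \<omega>) \<Otimes>\<^sub>M distr M borel (\<lambda>\<omega>. X t \<omega> - X s \<omega>) =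
    distr M (borel \<Otimes>\<^sub>M borel) (\<lambda>\<omega>. (\<lambda>n. X (e n) \<omega>, X t \<omega> - X s \<omega>))"
proof -
  interpret prob_space M by fact
  have Xm [measurable]: "X u \<in> borel_measurable M" if "u \<in> {0..T}" for u
    using X that by (auto simp: cadlag_process_def)
  let ?A = "sets (vimage_algebra (space M) (\<lambda>\<omega>. X t \<omega> - X s \<omega>) borel)"
  let ?G = "\<Union>u\<in>{0..s}. sets (vimage_algebra (space M) (X u) borel)"
  let ?B = "sigma_sets (space M) ?G"
  have ind: "indep_set ?A ?B"
    using I s by (auto simp: independent_increments_def)
  have G: "?G \<subseteq> Pow (space M)"
    using sets.sets_into_space by fastforce
  have "(\<lambda>\<omega> n. X (e n) \<omega>) \<in> measurable (sigma (space M) ?G) borel"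
  proof (rule measurable_coordinatewise_then_product, rule measurableI)
    fix n :: nat and S :: "real set" assume "S \<in> sets borel"
    then have "X (e n) -` S \<inter> space M \<in> sets (vimage_algebra (space M) (X (e n)) borel)"
      by (rule in_vimage_algebra)
    moreover have "e n \<in> {0..s}" using e by (meson range_subsetD)
    ultimately have "X (e n) -` S \<inter> space M \<in> ?G" by blast
    then show "X (e n) -` S \<inter> space (sigma (space M) ?G) \<in> sets (sigma (space M) ?G)"
      using G by auto
  qed auto
  note meas = this
  have B: "(\<lambda>\<omega> n. X (e n) \<omega>) -` S \<inter> space M \<in> ?B" if "S \<in> sets borel" for S
    using measurable_sets[OF meas that] G by (simp add: space_measure_of_conv sets_measure_of)
  have m: "(\<lambda>\<omega> n. X (e n) \<omega>) \<in> borel_measurable M"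
  proof (intro measurable_coordinatewise_then_product Xm)
    show "e n \<in> {0..T}" for n using range_subsetD[OF e, of n] s by auto
  qed
  have m': "(\<lambda>\<omega>. X t \<omega> - X s \<omega>) \<in> borel_measurable M"
    using s by (intro borel_measurable_diff Xm) auto
  interpret D1: prob_space "distr M borel (\<lambda>\<omega> n. X (e n) \<omega>)" by (rule prob_space_distr[OF m])
  interpret D2: prob_space "distr M borel (\<lambda>\<omega>. X t \<omega> - X s \<omega>)" by (rule prob_space_distr[OF m'])
  show ?thesis
  proof (rule pair_measure_eqI)
    fix S S' assume "S \<in> sets (distr M borel (\<lambda>\<omega> n. X (e n) \<omega>))" "S' \<in> sets (distr M borel (\<lambda>\<omega>. X t \<omega> - X s \<omega>))"
    then have S: "S \<in> sets borel" "S' \<in> sets borel" by auto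
    then have "prob (((\<lambda>\<omega>. X t \<omega> - X s \<omega>) -` S' \<inter> space M) \<inter> ((\<lambda>\<omega> n. X (e n) \<omega>) -` S \<inter> space M)) =
        prob ((\<lambda>\<omega>. X t \<omega> - X s \<omega>) -` S' \<inter> space M) * prob ((\<lambda>\<omega> n. X (e n) \<omega>) -` S \<inter> space M)"
      by (intro indep_setD[OF ind] B in_vimage_algebra)
    moreover have "((\<lambda>\<omega>. X t \<omega> - X s \<omega>) -` S' \<inter> space M) \<inter> ((\<lambda>\<omega> n. X (e n) \<omega>) -` S \<inter> space M) =
        (\<lambda>\<omega>. (\<lambda>n. X (e n) \<omega>, X t \<omega> - X s \<omega>)) -` (S \<times> S') \<inter> space M" by auto
    ultimately show "emeasure (distr M borel (\<lambda>\<omega> n. X (e n) \<omega>)) S * emeasure (distr M borel (\<lambda>\<omega>. X t \<omega> - X s \<omega>)) S' =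
        emeasure (distr M (borel \<Otimes>\<^sub>M borel) (\<lambda>\<omega>. (\<lambda>n. X (e n) \<omega>, X t \<omega> - X s \<omega>))) (S \<times> S')"
      using S m m' by (simp add: emeasure_distr emeasure_eq_measure measurable_Pair ennreal_mult'' mult.commute)
  qed (simp_all add: D1.sigma_finite_measure_axioms D2.sigma_finite_measure_axioms cong: sets_pair_measure_cong)
qed

text \<open>Induction by adding a new largest time \<open>b\<close>: its value is the value at the
  previous maximum plus an independent increment. Vectors are written as sequences that visit
  finitely many times, with repetitions, so that all dimensions share one type; \<open>e\<close> is
  arbitrary because the step re-enumerates the times.\<close>

lemma associated_finite_dim:
  fixes X :: "real \<Rightarrow> 'a \<Rightarrow> real" and e :: "nat \<Rightarrow> real"
  assumes M: "prob_space M" and X: "cadlag_process M T X" and I: "independent_increments M T X"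
    and S: "finite S" "S \<subseteq> {0..T}" "range e \<subseteq> S"
  shows "associated (distr M borel (\<lambda>\<omega> n. X (e n) \<omega>))"
  using S
proof (induction S arbitrary: e rule: finite_linorder_max_induct)
  case (insert b S)
  interpret prob_space M by fact
  have Xm [measurable]: "X u \<in> borel_measurable M" if "u \<in> {0..T}" for u
    using X that by (auto simp: cadlag_process_def)
  have b: "b \<in> {0..T}" using insert by auto
  show ?case
  proof (cases "S = {}")
    \<comment> \<open>The earliest time has no predecessor: every coordinate equals
      \<open>X b\<close>, whose law on the line is associated, and the passage to constant sequences
      is monotone.\<close>
    case True
    then have "e n = b" for n using insert by auto
    then have "(\<lambda>\<omega> n. X (e n) \<omega>) = (\<lambda>x n. x) \<circ> X b" by auto
    moreover have "(\<lambda>(x::real) (n::nat). x) \<in> borel_measurable borel"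
      by (rule measurable_coordinatewise_then_product) auto
    ultimately have eq: "distr M borel (\<lambda>\<omega> n. X (e n) \<omega>) = distr (distr M borel (X b)) borel (\<lambda>x n. x)"
      using b by (simp add: distr_distr)
    show ?thesis
      unfolding eq using b
      by (intro associated_distr associated_linorder prob_space_distr Xm)
        (auto intro!: monoI le_funI measurable_coordinatewise_then_product)
  next
    case False
    define a where "a = Max S"
    have a: "a \<in> S" "a < b" "\<And>x. x \<in> S \<Longrightarrow> x \<le> a"
      using False insert by (auto simp: a_def)
    \<comment> \<open>index \<open>0\<close> is reserved for time \<open>a\<close>, which \<open>e\<close> might not visit\<close>
    define e' where "e' = case_nat a (\<lambda>n. if e n = b then a else e n)"
    have re: "e n = b \<or> e n \<in> S" for n using insert.prems by auto
    then have e': "range e' \<subseteq> S" using a by (force simp: e'_def split: nat.splits if_splits)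
    have IH: "associated (distr M borel (\<lambda>\<omega> n. X (e' n) \<omega>))"
      using insert.IH e' insert.prems by auto
    \<comment> \<open>\<open>y 0\<close> is the value at time \<open>a\<close> and
      \<open>y (Suc n)\<close> is coordinate \<open>n\<close> of the old enumeration. Only
      selections and one addition occur, so \<open>h\<close> is increasing in both
      arguments.\<close>
    define h where "h = (\<lambda>(y::nat\<Rightarrow>real, d::real) n. if e n = b then y 0 + d else y (Suc n))"
    have hm: "h \<in> measurable (borel \<Otimes>\<^sub>M borel) borel"
    proof (rule measurable_coordinatewise_then_product)
      fix n :: nat
      have [measurable]: "(\<lambda>z::(nat \<Rightarrow> real) \<times> real. fst z k) \<in> borel_measurable (borel \<Otimes>\<^sub>M borel)" for k
        by (rule measurable_compose[OF measurable_fst measurable_product_coordinates])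
      show "(\<lambda>z. h z n) \<in> borel_measurable (borel \<Otimes>\<^sub>M borel)"
        unfolding h_def split_beta by measurable
    qed
    have "range e' \<subseteq> {0..a}" using e' a(3) insert.prems(1) by (fastforce simp: image_subset_iff)
    moreover have "0 \<le> a" "a \<le> b" "b \<le> T" using a insert.prems by auto
    ultimately have prod: "distr M borel (\<lambda>\<omega> n. X (e' n) \<omega>) \<Otimes>\<^sub>M distr M borel (\<lambda>\<omega>. X b \<omega> - X a \<omega>) =
        distr M (borel \<Otimes>\<^sub>M borel) (\<lambda>\<omega>. (\<lambda>n. X (e' n) \<omega>, X b \<omega> - X a \<omega>))"
      using M X I by (intro independent_increments_distr_pair) auto
    have m: "(\<lambda>\<omega> n. X (e' n) \<omega>) \<in> borel_measurable M" "(\<lambda>\<omega>. X b \<omega> - X a \<omega>) \<in> borel_measurable M"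
      using range_subsetD[OF subset_trans[OF e'(1)], of "{0..T}"] a insert.prems
      by (auto intro!: measurable_coordinatewise_then_product borel_measurable_diff Xm)
    have hX: "(\<lambda>\<omega> n. X (e n) \<omega>) = h \<circ> (\<lambda>\<omega>. (\<lambda>n. X (e' n) \<omega>, X b \<omega> - X a \<omega>))"
      by (auto simp: h_def e'_def fun_eq_iff)
    have "distr M borel (\<lambda>\<omega> n. X (e n) \<omega>) =
        distr (distr M borel (\<lambda>\<omega> n. X (e' n) \<omega>) \<Otimes>\<^sub>M distr M borel (\<lambda>\<omega>. X b \<omega> - X a \<omega>)) borel h"
      unfolding prod hX using m hm by (intro distr_distr[symmetric]) auto
    also have "associated \<dots>"
    proof (rule associated_distr_pair)
      show "prob_space (distr M borel (\<lambda>\<omega> n. X (e' n) \<omega>))" "prob_space (distr M borel (\<lambda>\<omega>. X b \<omega> - X a \<omega>))"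
        using m by (simp_all add: prob_space_distr)
      then show "associated (distr M borel (\<lambda>\<omega>. X b \<omega> - X a \<omega>))"
        by (intro associated_linorder)
      show "h \<in> measurable (distr M borel (\<lambda>\<omega> n. X (e' n) \<omega>) \<Otimes>\<^sub>M distr M borel (\<lambda>\<omega>. X b \<omega> - X a \<omega>)) borel"
        unfolding prod using hm by simp
      show "h (x, y) \<le> h (x', y')" if "x \<le> x'" "y \<le> y'" for x x' :: "nat \<Rightarrow> real" and y y'
        using that by (auto simp: h_def le_fun_def add_mono)
    qed (use IH in auto)
    finally show ?thesis .
  qed
qed auto

section \<open>Increasing events of sequences\<close>

text \<open>For a convergent sequence in the set, compactness of \<open>K\<close> yields a
  convergent subsequence of the witnesses, and the finitely many coordinate inequalities survive in
  the limit.\<close>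

lemma closed_upset_prefix:
  fixes K :: "(nat \<Rightarrow> real) set"
  assumes "compact K"
  shows "closed {x. \<exists>y\<in>K. \<forall>i\<le>n. y i \<le> x i}"
  unfolding closed_sequential_limits
proof (intro allI impI)
  have coord: "(\<lambda>k. u k i) \<longlonglongrightarrow> l i" if "u \<longlonglongrightarrow> l" for u and l :: "nat \<Rightarrow> real" and i
    using continuous_on_tendsto_compose[OF continuous_on_product_coordinates[of i] that] by simp
  fix x l
  assume "(\<forall>k. x k \<in> {x. \<exists>y\<in>K. \<forall>i\<le>n. y i \<le> x i}) \<and> x \<longlonglongrightarrow> l"
  then obtain y where y: "\<And>k. y k \<in> K" "\<And>k i. i \<le> n \<Longrightarrow> y k i \<le> x k i" and x: "x \<longlonglongrightarrow> l"
    by simp metis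
  then obtain m r where m: "m \<in> K" "strict_mono r" "(y \<circ> r) \<longlonglongrightarrow> m"
    using assms unfolding compact_def by metis
  have "m i \<le> l i" if "i \<le> n" for i
  proof (rule LIMSEQ_le)
    show "(\<lambda>k. (y \<circ> r) k i) \<longlonglongrightarrow> m i" "(\<lambda>k. (x \<circ> r) k i) \<longlonglongrightarrow> l i"
      by (intro coord m(3) LIMSEQ_subseq_LIMSEQ[OF x m(2)])+
    show "\<exists>N. \<forall>k\<ge>N. (y \<circ> r) k i \<le> (x \<circ> r) k i"
      using y(2)[OF that] by auto
  qed
  then show "l \<in> {x. \<exists>y\<in>K. \<forall>i\<le>n. y i \<le> x i}" using m by auto
qed

text \<open>This identifies the intersection of the cylinders with the upward closure of
  \<open>K\<close>: a limit point of the witnesses lies below \<open>x\<close> in every coordinate,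
  since the constraint on coordinate \<open>i\<close> holds from index \<open>i\<close> on.\<close>

lemma compact_upset_prefixes:
  fixes K :: "(nat \<Rightarrow> real) set"
  assumes "compact K" "\<And>n. \<exists>y\<in>K. \<forall>i\<le>n. y i \<le> x i"
  shows "\<exists>y\<in>K. y \<le> x"
proof -
  obtain y where y: "\<And>n. y n \<in> K" "\<And>n i. i \<le> n \<Longrightarrow> y n i \<le> x i"
    using assms(2) by metis
  then obtain m r where m: "m \<in> K" "strict_mono r" "(y \<circ> r) \<longlonglongrightarrow> m"
    using assms(1) unfolding compact_def by metis
  have "m i \<le> x i" for i
  proof (rule LIMSEQ_le_const2)
    show "(\<lambda>k. (y \<circ> r) k i) \<longlonglongrightarrow> m i"
      using continuous_on_tendsto_compose[OF continuous_on_product_coordinates[of i] m(3)] by simp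
    show "\<exists>N. \<forall>k\<ge>N. (y \<circ> r) k i \<le> x i"
      using y(2) order_trans[OF _ seq_suble[OF m(2)]] by (intro exI[of _ i]) auto
  qed
  then show ?thesis using m by (auto simp: le_fun_def)
qed

text \<open>The map \<open>\<lambda>x i. x (min i n)\<close> freezes all coordinates after
  \<open>n\<close>, so \<open>fd\<close> speaks of the law of the first \<open>n + 1\<close>
  coordinates. \<open>U\<close> and \<open>V\<close> are closed upwards only towards points of
  \<open>S\<close>; the upward closures of compact subsets may leave them elsewhere, but only on a
  null set.\<close>

lemma upset_positive_correlation:
  fixes N :: "(nat \<Rightarrow> real) measure"
  assumes N: "prob_space N" "sets N = sets borel"
    and fd: "\<And>n. associated (distr N borel (\<lambda>x i. x (min i n)))"
    and S: "S \<in> sets borel" "measure N S = 1"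
    and U: "U \<in> sets borel" "\<And>x y. x \<in> U \<Longrightarrow> y \<in> S \<Longrightarrow> x \<le> y \<Longrightarrow> y \<in> U"
    and V: "V \<in> sets borel" "\<And>x y. x \<in> V \<Longrightarrow> y \<in> S \<Longrightarrow> x \<le> y \<Longrightarrow> y \<in> V"
  shows "measure N U * measure N V \<le> measure N (U \<inter> V)"
proof -
  interpret prob_space N by fact
  have sp [simp]: "space N = UNIV" using sets_eq_imp_space_eq[OF N(2)] by simp
  note [measurable_cong] = N(2)
  have cut: "measure N (A \<inter> S) = measure N A" if "A \<in> sets borel" for A
    using AE_prob_1[OF S(2)] S(1) that by (intro finite_measure_eq_AE) (auto simp: N elim: eventually_mono)
  have compact_case: "measure N K * measure N L \<le> measure N (U \<inter> V)"
    if K: "compact K" "K \<subseteq> U" and L: "compact L" "L \<subseteq> V" for K L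
  proof -
    define C where "C K n = {x::nat\<Rightarrow>real. \<exists>y\<in>K. \<forall>i\<le>n. y i \<le> x i}" for K n
    have Cb: "C A n \<in> sets borel" if "compact A" for A n
      using closed_upset_prefix[OF that] by (simp add: C_def borel_closed)
    have dec: "decseq (C A)" for A
      by (intro decseq_SucI) (auto simp: C_def intro: le_SucI)
    have sub: "measure N A \<le> measure N (\<Inter>n. C A n)" if "compact A" for A
      using Cb[OF that] by (intro finite_measure_mono) (auto simp: C_def N)
    have "measure N (C K n) * measure N (C L n) \<le> measure N (C K n \<inter> C L n)" for n
    proof -
      let ?p = "\<lambda>(x::nat\<Rightarrow>real) i. x (min i n)"
      have p [measurable]: "?p \<in> measurable N borel"
        unfolding measurable_cong_sets[OF N(2) refl]
        by (intro measurable_coordinatewise_then_product measurable_product_coordinates)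
      have vim: "?p -` C A n = C A n" for A
        by (simp add: C_def min_def vimage_def)
      have mono: "mono (indicator (C A n) :: _ \<Rightarrow> real)" for A
      proof (rule monoI)
        have "y \<in> C A n" if "x \<in> C A n" "x \<le> y" for x y
          using that unfolding C_def mem_Collect_eq le_fun_def by (meson order_trans)
        then show "indicator (C A n) x \<le> (indicator (C A n) y :: real)" if "x \<le> y" for x y
          using that by (auto simp: indicator_def)
      qed
      have bd: "bounded (range (indicator (C A n) :: _ \<Rightarrow> real))" for A
        by (auto simp: bounded_iff indicator_def intro!: exI[of _ 1])
      have [measurable]: "C K n \<in> sets borel" "C L n \<in> sets borel" using Cb K L by auto
      have "(\<integral>x. indicat_real (C K n) x \<partial>distr N borel ?p) * (\<integral>x. indicat_real (C L n) x \<partial>distr N borel ?p) \<le>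
        (\<integral>x. indicat_real (C K n) x * indicat_real (C L n) x \<partial>distr N borel ?p)"
        by (intro associatedD[OF fd] mono bd) auto
      then show ?thesis
        by (simp add: indicator_inter_arith[symmetric] measure_distr vim)
    qed
    moreover have "(\<lambda>n. measure N (C K n) * measure N (C L n)) \<longlonglongrightarrow> measure N (\<Inter>n. C K n) * measure N (\<Inter>n. C L n)"
      using Cb K L dec by (intro tendsto_mult finite_Lim_measure_decseq) (auto simp: N)
    moreover have "(\<lambda>n. measure N (C K n \<inter> C L n)) \<longlonglongrightarrow> measure N (\<Inter>n. C K n \<inter> C L n)"
    proof (rule finite_Lim_measure_decseq)
      show "decseq (\<lambda>n. C K n \<inter> C L n)"
        using dec unfolding decseq_def by (blast intro: Int_mono)
    qed (use Cb K L in \<open>auto simp: N\<close>)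
    ultimately have "measure N (\<Inter>n. C K n) * measure N (\<Inter>n. C L n) \<le> measure N (\<Inter>n. C K n \<inter> C L n)"
      by (intro LIMSEQ_le) auto
    also have "\<dots> = measure N ((\<Inter>n. C K n \<inter> C L n) \<inter> S)"
      using Cb K L by (intro cut[symmetric]) auto
    also have "\<dots> \<le> measure N (U \<inter> V)"
    proof (rule finite_measure_mono)
      show "(\<Inter>n. C K n \<inter> C L n) \<inter> S \<subseteq> U \<inter> V"
      proof
        fix x assume x: "x \<in> (\<Inter>n. C K n \<inter> C L n) \<inter> S"
        then obtain y z where "y \<in> K" "y \<le> x" "z \<in> L" "z \<le> x"
          using compact_upset_prefixes[OF K(1), of x] compact_upset_prefixes[OF L(1), of x]
          by (auto simp: C_def)
        then show "x \<in> U \<inter> V"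
          using U(2)[of y x] V(2)[of z x] x K(2) L(2) by auto
      qed
    qed (use U V N in auto)
    finally show ?thesis
      using mult_mono[OF sub[OF K(1)] sub[OF L(1)]] by simp
  qed
  have fin: "emeasure N (space N) \<noteq> \<infinity>" by simp
  \<comment> \<open>Inner regularity of finite Borel measures on the Polish space of sequences; both
    suprema over compact subsets are pulled out of the product.\<close>
  have "emeasure N U * emeasure N V =
      (SUP L\<in>{L. L \<subseteq> V \<and> compact L}. SUP K\<in>{K. K \<subseteq> U \<and> compact K}. emeasure N K * emeasure N L)"
    by (simp only: inner_regular[OF N(2) fin U(1)] inner_regular[OF N(2) fin V(1)]
      SUP_mult_left_ennreal SUP_mult_right_ennreal)
  also have "\<dots> \<le> emeasure N (U \<inter> V)"
    using compact_case by (intro SUP_least) (auto simp: emeasure_eq_measure ennreal_mult'[symmetric])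
  finally show ?thesis
    by (simp add: emeasure_eq_measure ennreal_mult'[symmetric])
qed

section \<open>From increasing events to bounded monotone functions\<close>

text \<open>\<open>f\<close> is the uniform limit of \<open>\<lfloor>n f\<rfloor> / n\<close>, up to a constant a positive combination of indicators of superlevel sets.\<close>
lemma (in prob_space) correlation_le_of_superlevel:
  fixes f h :: "'a \<Rightarrow> real"
  assumes h: "h \<in> borel_measurable M" "\<And>x. \<bar>h x\<bar> \<le> A" and f: "f \<in> borel_measurable M" "\<And>x. \<bar>f x\<bar> \<le> B"
    and le: "\<And>c. expectation h * prob {x \<in> space M. c \<le> f x} \<le> expectation (\<lambda>x. h x * indicator {x \<in> space M. c \<le> f x} x)"
  shows "expectation h * expectation f \<le> expectation (\<lambda>x. h x * f x)"
proof -
  have inth: "integrable M h" using h by (intro integrable_const_bound[where B=A]) auto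
  \<comment> \<open>After centring, a constant multiple of \<open>h'\<close> integrates to zero, so
    the additive constant in the decomposition of the floor below costs nothing.\<close>
  define h' where "h' x = h x - expectation h" for x
  have h' [measurable]: "h' \<in> borel_measurable M"
    unfolding h'_def[abs_def] using h(1) by (intro borel_measurable_diff) auto
  have bh': "\<bar>h' x\<bar> \<le> A + \<bar>expectation h\<bar>" for x
    using h(2)[of x] by (auto simp: h'_def)
  note [measurable] = f(1) h(1)
  have inth': "integrable M (\<lambda>x. h' x * u x)" if [measurable]: "u \<in> borel_measurable M" and "\<And>x. \<bar>u x\<bar> \<le> C" for u :: "'a \<Rightarrow> real" and C
  proof (rule integrable_const_bound[where B="(A + \<bar>expectation h\<bar>) * C"])
    show "AE x in M. norm (h' x * u x) \<le> (A + \<bar>expectation h\<bar>) * C"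
      using mult_mono'[OF bh' that(2)] by (auto simp: abs_mult)
  qed auto
  have h'0: "expectation h' = 0"
    unfolding h'_def[abs_def] using inth by (simp add: prob_space)
  have hind: "0 \<le> expectation (\<lambda>x. h' x * indicator {x \<in> space M. c \<le> f x} x)" for c
  proof -
    have "integrable M (\<lambda>x. h x * indicator {x \<in> space M. c \<le> f x} x)"
      using inth by (intro integrable_real_mult_indicator) auto
    moreover have "integrable M (\<lambda>x. expectation h * indicator {x \<in> space M. c \<le> f x} x)"
      by (intro integrable_mult_right integrable_real_indicator) (auto simp: emeasure_eq_measure)
    ultimately have "expectation (\<lambda>x. h' x * indicator {x \<in> space M. c \<le> f x} x) =
      expectation (\<lambda>x. h x * indicator {x \<in> space M. c \<le> f x} x) - expectation h * prob {x \<in> space M. c \<le> f x}"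
      by (simp add: h'_def left_diff_distrib)
    then show ?thesis using le[of c] by simp
  qed
  have step: "0 \<le> expectation (\<lambda>x. h' x * (of_int \<lfloor>real (Suc n) * f x\<rfloor> / real (Suc n)))" for n
  proof -
    define m where "m = \<lceil>real (Suc n) * B\<rceil> + 1"
    \<comment> \<open>Integer layer-cake formula: for \<open>v = real (Suc n) * f x\<close>, the
      number of \<open>k\<close> in \<open>{-m<..m}\<close> with \<open>k \<le> v\<close> is the
      floor of \<open>v\<close> plus \<open>m\<close>, because \<open>m\<close> bounds that floor in
      absolute value.\<close>
    have rep: "of_int \<lfloor>real (Suc n) * f x\<rfloor> =
      (\<Sum>k\<in>{-m<..m}. indicator {x \<in> space M. of_int k / real (Suc n) \<le> f x} x) - (of_int m :: real)" if "x \<in> space M" for x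
    proof -
      have "\<bar>real (Suc n) * f x\<bar> \<le> real (Suc n) * B"
        using f(2)[of x] by (simp add: abs_mult)
      then have fl: "-m \<le> \<lfloor>real (Suc n) * f x\<rfloor>" "\<lfloor>real (Suc n) * f x\<rfloor> \<le> m"
        unfolding m_def by linarith+
      have "(\<Sum>k\<in>{-m<..m}. indicator {x \<in> space M. of_int k / real (Suc n) \<le> f x} x :: real) =
         (\<Sum>k\<in>{-m<..m}. indicator {..\<lfloor>real (Suc n) * f x\<rfloor>} k)"
        using that by (intro sum.cong) (auto simp: indicator_def le_floor_iff field_simps simp del: of_nat_Suc)
      also have "\<dots> = real (card ({-m<..m} \<inter> {..\<lfloor>real (Suc n) * f x\<rfloor>}))"
        by (simp add: indicator_def[abs_def] sum_of_bool_eq atMost_def del: of_nat_Suc)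
      also have "{-m<..m} \<inter> {..\<lfloor>real (Suc n) * f x\<rfloor>} = {-m<..\<lfloor>real (Suc n) * f x\<rfloor>}"
        using fl by auto
      finally show ?thesis using fl by simp
    qed
    define J where "J k x = h' x * indicator {x \<in> space M. of_int k / real (Suc n) \<le> f x} x" for k x
    have J: "integrable M (J k)" "0 \<le> expectation (J k)" for k
      unfolding J_def[abs_def] by (rule inth'[of _ 1]; simp add: indicator_def) (rule hind)
    have "expectation (\<lambda>x. h' x * (of_int \<lfloor>real (Suc n) * f x\<rfloor> / real (Suc n))) =
      expectation (\<lambda>x. (\<Sum>k\<in>{-m<..m}. J k x) / real (Suc n) - h' x * (of_int m / real (Suc n)))"
    proof (intro Bochner_Integration.integral_cong refl)
      fix x assume "x \<in> space M"
      from rep[OF this] show "h' x * (of_int \<lfloor>real (Suc n) * f x\<rfloor> / real (Suc n)) =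
        (\<Sum>k\<in>{-m<..m}. J k x) / real (Suc n) - h' x * (of_int m / real (Suc n))"
        by (simp only: J_def sum_distrib_left[symmetric] right_diff_distrib diff_divide_distrib times_divide_eq_right)
    qed
    also have "\<dots> = (\<Sum>k\<in>{-m<..m}. expectation (J k)) / real (Suc n) - expectation h' * (of_int m / real (Suc n))"
    proof -
      have "integrable M (\<lambda>x. (\<Sum>k\<in>{-m<..m}. J k x) / real (Suc n))"
        by (intro integrable_divide Bochner_Integration.integrable_sum J)
      moreover have "integrable M (\<lambda>x. h' x * (of_int m / real (Suc n)))"
        by (rule inth'[of _ "\<bar>of_int m / real (Suc n)\<bar>"]) auto
      ultimately show ?thesis
        by (simp only: Bochner_Integration.integral_diff integral_divide_zero integral_mult_left_zero
            Bochner_Integration.integral_sum[OF J(1)])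
    qed
    finally show ?thesis
      using J(2) h'0 by (simp add: sum_nonneg del: of_nat_Suc)
  qed
  have "(\<lambda>n. expectation (\<lambda>x. h' x * (of_int \<lfloor>real (Suc n) * f x\<rfloor> / real (Suc n)))) \<longlonglongrightarrow> expectation (\<lambda>x. h' x * f x)"
  proof (rule integral_dominated_convergence[where w="\<lambda>x. (A + \<bar>expectation h\<bar>) * (B + 1)"])
    have fl: "\<bar>of_int \<lfloor>real (Suc n) * f x\<rfloor> / real (Suc n) - f x\<bar> \<le> 1 / real (Suc n)" for n x
    proof -
      have "\<bar>of_int \<lfloor>real (Suc n) * f x\<rfloor> - real (Suc n) * f x\<bar> \<le> 1" by linarith
      then have "\<bar>(of_int \<lfloor>real (Suc n) * f x\<rfloor> - real (Suc n) * f x) / real (Suc n)\<bar> \<le> 1 / real (Suc n)"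
        by (simp add: divide_right_mono del: of_nat_Suc)
      then show ?thesis by (simp add: diff_divide_distrib del: of_nat_Suc)
    qed
    show "AE x in M. (\<lambda>n. h' x * (of_int \<lfloor>real (Suc n) * f x\<rfloor> / real (Suc n))) \<longlonglongrightarrow> h' x * f x"
    proof (intro AE_I2 tendsto_mult tendsto_const)
      fix x
      have "(\<lambda>n. 1 / real (Suc n)) \<longlonglongrightarrow> 0" using LIMSEQ_Suc[OF lim_1_over_n] .
      then have "(\<lambda>n. of_int \<lfloor>real (Suc n) * f x\<rfloor> / real (Suc n) - f x) \<longlonglongrightarrow> 0"
        by (rule Lim_null_comparison[rotated]) (use fl in auto)
      then show "(\<lambda>n. of_int \<lfloor>real (Suc n) * f x\<rfloor> / real (Suc n)) \<longlonglongrightarrow> f x"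
        by (simp add: LIM_zero_iff)
    qed
    fix n
    have "\<bar>of_int \<lfloor>real (Suc n) * f x\<rfloor> / real (Suc n)\<bar> \<le> B + 1" for x
    proof -
      have "1 / real (Suc n) \<le> 1" by simp
      then show ?thesis using fl[of n x] f(2)[of x] by linarith
    qed
    then show "AE x in M. norm (h' x * (of_int \<lfloor>real (Suc n) * f x\<rfloor> / real (Suc n))) \<le> (A + \<bar>expectation h\<bar>) * (B + 1)"
      unfolding real_norm_def abs_mult by (intro AE_I2 mult_mono' bh') auto
  qed auto
  then have "0 \<le> expectation (\<lambda>x. h' x * f x)"
    by (rule LIMSEQ_le_const) (use step in auto)
  also have "\<dots> = expectation (\<lambda>x. h x * f x) - expectation h * expectation f"
  proof -
    have "integrable M f" using f by (intro integrable_const_bound[where B=B]) auto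
    moreover have "integrable M (\<lambda>x. h x * f x)"
      using mult_mono'[OF h(2) f(2)] by (intro integrable_const_bound[where B="A*B"]) (auto simp: abs_mult)
    ultimately show ?thesis by (simp add: h'_def left_diff_distrib)
  qed
  finally show ?thesis by simp
qed

text \<open>Superlevel sets of \<open>f\<close> and \<open>g\<close>, cut down to \<open>S\<close>,
  are increasing events. The reduction to superlevel sets is then used twice: first it replaces the
  event of \<open>g\<close> by \<open>g\<close> against a fixed indicator, then the event of
  \<open>f\<close> by \<open>f\<close> against \<open>g\<close>.\<close>

lemma monotone_positive_correlation:
  fixes N :: "(nat \<Rightarrow> real) measure" and f g :: "(nat \<Rightarrow> real) \<Rightarrow> real"
  assumes N: "prob_space N" "sets N = sets borel"
    and fd: "\<And>n. associated (distr N borel (\<lambda>x i. x (min i n)))"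
    and S: "S \<in> sets borel" "measure N S = 1"
    and f: "f \<in> borel_measurable borel" "bounded (range f)" "mono_on S f"
    and g: "g \<in> borel_measurable borel" "bounded (range g)" "mono_on S g"
  shows "(\<integral>x. f x \<partial>N) * (\<integral>x. g x \<partial>N) \<le> (\<integral>x. f x * g x \<partial>N)"
proof -
  interpret prob_space N by fact
  have sp [simp]: "space N = UNIV" using sets_eq_imp_space_eq[OF N(2)] by simp
  note [measurable_cong] = N(2)
  note [measurable] = f(1) g(1) S(1)
  obtain A B where A: "\<And>x. \<bar>f x\<bar> \<le> A" and B: "\<And>x. \<bar>g x\<bar> \<le> B"
    using f g by (auto simp: bounded_iff)
  have cut: "measure N (A \<inter> S) = measure N A" if "A \<in> sets borel" for A
    using AE_prob_1[OF S(2)] S(1) that by (intro finite_measure_eq_AE) (auto simp: N elim: eventually_mono)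
  have sets: "prob {x. c \<le> f x} * prob {x. d \<le> g x} \<le> prob ({x. c \<le> f x} \<inter> {x. d \<le> g x})" for c d
  proof -
    have "prob ({x. c \<le> f x} \<inter> S) * prob ({x. d \<le> g x} \<inter> S) \<le> prob (({x. c \<le> f x} \<inter> S) \<inter> ({x. d \<le> g x} \<inter> S))"
      by (rule upset_positive_correlation[OF N fd S])
        (use f g in \<open>auto dest: mono_onD intro: order_trans\<close>)
    also have "({x. c \<le> f x} \<inter> S) \<inter> ({x. d \<le> g x} \<inter> S) = ({x. c \<le> f x} \<inter> {x. d \<le> g x}) \<inter> S" by auto
    finally show ?thesis
      by (simp add: cut)
  qed
  have 1: "expectation g * prob {x. c \<le> f x} \<le> expectation (\<lambda>x. g x * indicator {x. c \<le> f x} x)" for c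
  proof -
    have "expectation (indicator {x. c \<le> f x}) * expectation g \<le> expectation (\<lambda>x. indicator {x. c \<le> f x} x * g x)"
    proof (rule correlation_le_of_superlevel[where A=1 and B=B])
      show "expectation (indicator {x. c \<le> f x}) * prob {x \<in> space N. d \<le> g x}
         \<le> expectation (\<lambda>x. indicator {x. c \<le> f x} x * indicator {x \<in> space N. d \<le> g x} x)" for d
        using sets[of c d] by (simp add: indicator_inter_arith[symmetric])
    qed (auto simp: indicator_def B)
    then show ?thesis by (simp add: mult.commute)
  qed
  have "expectation g * expectation f \<le> expectation (\<lambda>x. g x * f x)"
    by (rule correlation_le_of_superlevel[where A=B and B=A]) (use A B 1 in auto)
  then show ?thesis by (simp add: mult.commute)
qed

section \<open>Cadlag paths coded by countably many values\<close>

text \<open>The value at \<open>T\<close> is no right limit of earlier values, so \<open>T\<close>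
  must itself be among the coded times; every earlier value is recoverable from dense times to its
  right.\<close>

locale dense_times =
  fixes T :: real and e :: "nat \<Rightarrow> real" and top_index :: nat
  assumes T_pos: "0 < T" and e_range: "e i \<in> {0..T}" and e_top: "e top_index = T"
    and dense: "0 \<le> a \<Longrightarrow> a < b \<Longrightarrow> b \<le> T \<Longrightarrow> \<exists>i. a < e i \<and> e i < b"
begin

text \<open>
  Among any three nearby times, the middle value is close to one of the outer ones (Billingsley's
  modulus \<open>w''\<close>). No right-continuity at the times \<open>e i\<close> is imposed: \<open>trace_path\<close> only uses right limits
  before \<open>T\<close>, so it need not interpolate a trace that does not come from a cadlag path.
\<close>
definition cadlag_trace :: "(nat \<Rightarrow> real) \<Rightarrow> bool" where
  "cadlag_trace x \<longleftrightarrow> (\<forall>m. \<exists>n. \<forall>i j k. e i \<le> e j \<and> e j \<le> e k \<and> e k < e i + 1 / real (Suc n) \<longrightarrow>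
     \<bar>x j - x i\<bar> \<le> 1 / real (Suc m) \<or> \<bar>x k - x j\<bar> \<le> 1 / real (Suc m))"

text \<open>The indices depend on \<open>t\<close> but not on the trace. Hence decoding at
  \<open>t\<close> is a limit of fixed coordinates, which makes it measurable and monotone in the
  trace. The chosen times lie strictly after \<open>t\<close>, so a trace value at \<open>t\<close>
  itself never enters.\<close>

definition right_index :: "real \<Rightarrow> nat \<Rightarrow> nat" where
  "right_index t k = (SOME i. t < e i \<and> e i < min T (t + 1 / real (Suc k)))"

definition trace_path :: "(nat \<Rightarrow> real) \<Rightarrow> real \<Rightarrow> real" where
  "trace_path x = (\<lambda>t\<in>{0..T}. if t = T then x top_index else lim (\<lambda>k. x (right_index t k)))"

lemma right_index:
  assumes "0 \<le> t" "t < T"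
  shows "t < e (right_index t k)" "e (right_index t k) < T" "e (right_index t k) < t + 1 / real (Suc k)"
proof -
  have "\<exists>i. t < e i \<and> e i < min T (t + 1 / real (Suc k))"
    using assms by (intro dense) auto
  from someI_ex[OF this] show "t < e (right_index t k)" "e (right_index t k) < T" "e (right_index t k) < t + 1 / real (Suc k)"
    by (auto simp: right_index_def)
qed

lemma right_index_LIMSEQ:
  assumes "0 \<le> t" "t < T"
  shows "(\<lambda>k. e (right_index t k)) \<longlonglongrightarrow> t"
proof (rule tendsto_sandwich[where f="\<lambda>_. t" and h="\<lambda>k. t + 1 / real (Suc k)"])
  have "(\<lambda>k. 1 / real (Suc k)) \<longlonglongrightarrow> 0" using LIMSEQ_Suc[OF lim_1_over_n] .
  then show "(\<lambda>k. t + 1 / real (Suc k)) \<longlonglongrightarrow> t" using tendsto_add[OF tendsto_const[of t]] by force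
qed (use right_index[OF assms] in \<open>auto intro!: always_eventually less_imp_le simp del: of_nat_Suc\<close>)

text \<open>Tolerances and window lengths are of the form \<open>1 / real (Suc n)\<close> and times
  are indexed by naturals, so only countable unions and intersections of coordinate events
  occur.\<close>

lemma borel_cadlag_trace: "{x. cadlag_trace x} \<in> sets borel"
proof -
  have [measurable]: "(\<lambda>x::nat\<Rightarrow>real. x i) \<in> borel_measurable borel" for i
    by (rule measurable_product_coordinates)
  have "{x \<in> space borel. cadlag_trace x} \<in> sets borel"
    unfolding cadlag_trace_def by measurable
  then show ?thesis by simp
qed

text \<open>Otherwise there are ever shorter windows with two large jumps each, and their middle
  times accumulate at some \<open>t\<close>. Near \<open>t\<close> the path is close to its left
  limit before \<open>t\<close> and to \<open>\<alpha> t\<close> from \<open>t\<close> on. The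
  middle time shares one of these sides with an outer time, so one of the two jumps is
  small.\<close>

lemma cadlag_trace_compose:
  assumes "cadlag_on T \<alpha>"
  shows "cadlag_trace (\<lambda>i. \<alpha> (e i))"
proof (rule ccontr)
  assume "\<not> cadlag_trace (\<lambda>i. \<alpha> (e i))"
  then obtain m where "\<forall>n. \<exists>i j k. e i \<le> e j \<and> e j \<le> e k \<and> e k < e i + 1 / real (Suc n) \<and>
     \<bar>\<alpha> (e j) - \<alpha> (e i)\<bar> > 1 / real (Suc m) \<and> \<bar>\<alpha> (e k) - \<alpha> (e j)\<bar> > 1 / real (Suc m)"
    unfolding cadlag_trace_def by (auto simp: not_le)
  then obtain i j k where ijk: "\<And>n. e (i n) \<le> e (j n)" "\<And>n. e (j n) \<le> e (k n)" "\<And>n. e (k n) < e (i n) + 1 / real (Suc n)"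
    and big: "\<And>n. \<bar>\<alpha> (e (j n)) - \<alpha> (e (i n))\<bar> > 1 / real (Suc m)" "\<And>n. \<bar>\<alpha> (e (k n)) - \<alpha> (e (j n))\<bar> > 1 / real (Suc m)"
    by metis
  define \<eta> where "\<eta> = 1 / real (Suc m) / 2"
  have \<eta>: "0 < \<eta>" "1 / real (Suc m) = 2 * \<eta>" by (simp_all add: \<eta>_def del: of_nat_Suc)
  obtain t r where t: "t \<in> {0..T}" "strict_mono r" "((\<lambda>n. e (j n)) \<circ> r) \<longlonglongrightarrow> t"
    using compact_Icc[of 0 T, unfolded compact_def] e_range by metis
  obtain dr where dr: "0 < dr" "\<And>s. t \<le> s \<Longrightarrow> s < t + dr \<Longrightarrow> s \<le> T \<Longrightarrow> \<bar>\<alpha> s - \<alpha> t\<bar> < \<eta>"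
  proof (cases "t < T")
    case True
    then have "(\<alpha> \<longlongrightarrow> \<alpha> t) (at_right t)" using assms t by (auto simp: cadlag_on_def)
    then have "eventually (\<lambda>s. dist (\<alpha> s) (\<alpha> t) < \<eta>) (at_right t)" using \<eta> by (intro tendstoD)
    then obtain b where "b > t" "\<And>s. t < s \<Longrightarrow> s < b \<Longrightarrow> dist (\<alpha> s) (\<alpha> t) < \<eta>"
      by (auto simp: eventually_at_right_field)
    then show ?thesis using \<eta> by (intro that[of "b - t"]) (auto simp: dist_real_def le_less)
  next
    \<comment> \<open>Here \<open>t = T\<close>, and the only time to control is \<open>t\<close>
      itself.\<close>
    case False
    then show ?thesis using t \<eta> by (intro that[of 1]) (auto simp: le_less)
  qed
  obtain l dl where dl: "0 < dl" "\<And>s. s < t \<Longrightarrow> t - dl < s \<Longrightarrow> 0 \<le> s \<Longrightarrow> \<bar>\<alpha> s - l\<bar> < \<eta>"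
  proof (cases "0 < t")
    case True
    then obtain l where "(\<alpha> \<longlongrightarrow> l) (at_left t)" using assms t by (auto simp: cadlag_on_def)
    then have "eventually (\<lambda>s. dist (\<alpha> s) l < \<eta>) (at_left t)" using \<eta> by (intro tendstoD)
    then obtain b where "b < t" "\<And>s. b < s \<Longrightarrow> s < t \<Longrightarrow> dist (\<alpha> s) l < \<eta>"
      by (auto simp: eventually_at_left_field)
    then show ?thesis using that[of "t - b" l] by (auto simp: dist_real_def)
  next
    case False
    then show ?thesis by (intro that[of 1 0]) auto
  qed
  define d where "d = min dl dr"
  have d: "0 < d" "d \<le> dl" "d \<le> dr" using dl dr by (auto simp: d_def)
  \<comment> \<open>One half of \<open>d\<close> absorbs the distance from the middle time to
    \<open>t\<close>, the other half the length of the window, so all three times are within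
    \<open>d\<close> of \<open>t\<close>.\<close>
  have "eventually (\<lambda>n. dist (((\<lambda>n. e (j n)) \<circ> r) n) t < d / 2) sequentially"
    by (rule tendstoD[OF t(3)]) (use d in simp)
  moreover have "eventually (\<lambda>n. 1 / real (Suc n) < d / 2) sequentially"
    using order_tendstoD(2)[OF LIMSEQ_Suc[OF lim_1_over_n], of "d / 2"] d by simp
  ultimately obtain n where n: "\<bar>e (j (r n)) - t\<bar> < d / 2" "1 / real (Suc n) < d / 2"
    using eventually_happens[OF eventually_conj] by (fastforce simp: dist_real_def)
  have "1 / real (Suc (r n)) \<le> 1 / real (Suc n)"
    using seq_suble[OF t(2), of n] by (simp add: field_simps)
  then have close: "e (k (r n)) < e (i (r n)) + d / 2" using ijk(3)[of "r n"] n by linarith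
  note o = ijk(1)[of "r n"] ijk(2)[of "r n"]
  note e_range[of "i (r n)"] e_range[of "j (r n)"] e_range[of "k (r n)"]
  note rng = this[unfolded atLeastAtMost_iff]
  show False
  proof (cases "e (j (r n)) < t")
    case True
    then have "\<bar>\<alpha> (e (j (r n))) - l\<bar> < \<eta>" "\<bar>\<alpha> (e (i (r n))) - l\<bar> < \<eta>"
      using n close o d rng by (intro dl(2); linarith)+
    then show False using big(1)[of "r n"] \<eta> by linarith
  next
    case False
    then have "\<bar>\<alpha> (e (j (r n))) - \<alpha> t\<bar> < \<eta>" "\<bar>\<alpha> (e (k (r n))) - \<alpha> t\<bar> < \<eta>"
      using n close o d rng by (intro dr(2); linarith)+
    then show False using big(2)[of "r n"] \<eta> by linarith
  qed
qed

lemma trace_path_compose: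
  assumes "\<alpha> \<in> cadlag_space T"
  shows "trace_path (\<lambda>i. \<alpha> (e i)) = \<alpha>"
proof
  fix t
  show "trace_path (\<lambda>i. \<alpha> (e i)) t = \<alpha> t"
  proof (cases "t \<in> {0..<T}")
    case True
    then have "(\<alpha> \<longlongrightarrow> \<alpha> t) (at_right t)"
      using assms by (auto simp: cadlag_space_def cadlag_on_def)
    moreover have "filterlim (\<lambda>k. e (right_index t k)) (at_right t) sequentially"
      using True right_index[of t] right_index_LIMSEQ[of t]
      by (auto simp: filterlim_at intro!: always_eventually less_imp_neq[symmetric])
    ultimately have "(\<lambda>k. \<alpha> (e (right_index t k))) \<longlonglongrightarrow> \<alpha> t"
      by (rule filterlim_compose)
    then show ?thesis using True by (auto simp: trace_path_def dest: limI)
  next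
    case False
    then show ?thesis using assms T_pos e_top
      by (auto simp: trace_path_def cadlag_space_def extensional_def)
  qed
qed

text \<open>Two successive pairs in a short window cannot both oscillate: if \<open>x a\<close> and
  \<open>x b\<close> are far apart, the three-point condition at \<open>a\<close>, \<open>b\<close>,
  \<open>c\<close> and at \<open>a\<close>, \<open>b\<close>, \<open>d\<close> puts both
  \<open>x c\<close> and \<open>x d\<close> within \<open>\<epsilon> / 2\<close> of
  \<open>x b\<close>.\<close>

lemma cadlag_trace_oscillation:
  assumes "cadlag_trace x" "0 < \<epsilon>"
  obtains \<delta> where "0 < \<delta>"
    "\<And>a b c d. e a \<le> e b \<Longrightarrow> e b \<le> e c \<Longrightarrow> e c \<le> e d \<Longrightarrow> e d < e a + \<delta> \<Longrightarrow>
       \<bar>x a - x b\<bar> \<le> \<epsilon> \<or> \<bar>x c - x d\<bar> \<le> \<epsilon>"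
proof -
  obtain m where m: "1 / real (Suc m) < \<epsilon> / 2"
    using nat_approx_posE[of "\<epsilon> / 2"] assms(2) by (metis half_gt_zero)
  obtain n where n: "\<And>i j k. e i \<le> e j \<Longrightarrow> e j \<le> e k \<Longrightarrow> e k < e i + 1 / real (Suc n) \<Longrightarrow>
     \<bar>x j - x i\<bar> \<le> 1 / real (Suc m) \<or> \<bar>x k - x j\<bar> \<le> 1 / real (Suc m)"
    using assms(1) unfolding cadlag_trace_def by metis
  show ?thesis
  proof (rule that)
    show "0 < 1 / real (Suc n)" by simp
    fix a b c d assume "e a \<le> e b" "e b \<le> e c" "e c \<le> e d" "e d < e a + 1 / real (Suc n)"
    then show "\<bar>x a - x b\<bar> \<le> \<epsilon> \<or> \<bar>x c - x d\<bar> \<le> \<epsilon>"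
      using n[of a b c] n[of a b d] m by argo
  qed
qed

text \<open>If oscillation persisted just after \<open>t\<close>, a second bad pair could be found
  between \<open>t\<close> and the first one, giving two successive oscillations in one short
  window.\<close>

lemma cadlag_trace_Cauchy_right:
  assumes x: "cadlag_trace x" and "0 < \<epsilon>"
  shows "\<exists>\<delta>>0. \<forall>i j. t < e i \<and> e i < t + \<delta> \<and> t < e j \<and> e j < t + \<delta> \<longrightarrow> \<bar>x i - x j\<bar> \<le> \<epsilon>"
proof (rule ccontr)
  assume c: "\<not> ?thesis"
  have bad: "\<exists>i j. t < e i \<and> e i \<le> e j \<and> e j < t + \<delta> \<and> \<not> \<bar>x i - x j\<bar> \<le> \<epsilon>" if "\<delta> > 0" for \<delta>
    using c that by (metis linorder_linear abs_minus_commute)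
  obtain \<delta> where \<delta>: "0 < \<delta>" "\<And>a b c d. e a \<le> e b \<Longrightarrow> e b \<le> e c \<Longrightarrow> e c \<le> e d \<Longrightarrow> e d < e a + \<delta> \<Longrightarrow>
       \<bar>x a - x b\<bar> \<le> \<epsilon> \<or> \<bar>x c - x d\<bar> \<le> \<epsilon>"
    using cadlag_trace_oscillation[OF assms] by metis
  obtain c d where cd: "t < e c" "e c \<le> e d" "e d < t + \<delta>" "\<not> \<bar>x c - x d\<bar> \<le> \<epsilon>"
    using bad[OF \<delta>(1)] by blast
  obtain a b where ab: "t < e a" "e a \<le> e b" "e b < t + (e c - t)" "\<not> \<bar>x a - x b\<bar> \<le> \<epsilon>"
    using bad[of "e c - t"] cd by auto
  show False using \<delta>(2)[of a b c d] ab cd by auto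
qed

text \<open>Mirror image: here the second bad pair is placed between the first one and
  \<open>t\<close>.\<close>

lemma cadlag_trace_Cauchy_left:
  assumes x: "cadlag_trace x" and "0 < \<epsilon>"
  shows "\<exists>\<delta>>0. \<forall>i j. t - \<delta> < e i \<and> e i < t \<and> t - \<delta> < e j \<and> e j < t \<longrightarrow> \<bar>x i - x j\<bar> \<le> \<epsilon>"
proof (rule ccontr)
  assume c: "\<not> ?thesis"
  have bad: "\<exists>i j. t - \<delta> < e i \<and> e i \<le> e j \<and> e j < t \<and> \<not> \<bar>x i - x j\<bar> \<le> \<epsilon>" if "\<delta> > 0" for \<delta>
    using c that by (metis linorder_linear abs_minus_commute)
  obtain \<delta> where \<delta>: "0 < \<delta>" "\<And>a b c d. e a \<le> e b \<Longrightarrow> e b \<le> e c \<Longrightarrow> e c \<le> e d \<Longrightarrow> e d < e a + \<delta> \<Longrightarrow>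
       \<bar>x a - x b\<bar> \<le> \<epsilon> \<or> \<bar>x c - x d\<bar> \<le> \<epsilon>"
    using cadlag_trace_oscillation[OF assms] by metis
  obtain a b where ab: "t - \<delta> < e a" "e a \<le> e b" "e b < t" "\<not> \<bar>x a - x b\<bar> \<le> \<epsilon>"
    using bad[OF \<delta>(1)] by blast
  obtain c d where cd: "t - (t - e b) < e c" "e c \<le> e d" "e d < t" "\<not> \<bar>x c - x d\<bar> \<le> \<epsilon>"
    using bad[of "t - e b"] ab by auto
  show False using \<delta>(2)[of a b c d] ab cd by auto
qed

lemma trace_path_LIMSEQ:
  assumes x: "cadlag_trace x" and t: "0 \<le> t" "t < T"
  shows "(\<lambda>k. x (right_index t k)) \<longlonglongrightarrow> trace_path x t"
proof -
  have "Cauchy (\<lambda>k. x (right_index t k))"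
  proof (rule metric_CauchyI)
    fix \<epsilon> :: real assume "0 < \<epsilon>"
    then obtain \<delta> where \<delta>: "\<delta> > 0" "\<And>i j. t < e i \<Longrightarrow> e i < t + \<delta> \<Longrightarrow> t < e j \<Longrightarrow> e j < t + \<delta> \<Longrightarrow> \<bar>x i - x j\<bar> \<le> \<epsilon> / 2"
      using cadlag_trace_Cauchy_right[OF x, of "\<epsilon> / 2" t] by auto
    have "eventually (\<lambda>k. e (right_index t k) < t + \<delta>) sequentially"
      using right_index_LIMSEQ[OF t] \<delta> by (intro order_tendstoD) auto
    then obtain K where "\<And>k. k \<ge> K \<Longrightarrow> e (right_index t k) < t + \<delta>"
      by (auto simp: eventually_sequentially)
    then have "\<bar>x (right_index t k) - x (right_index t l)\<bar> \<le> \<epsilon> / 2" if "k \<ge> K" "l \<ge> K" for k l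
      using \<delta>(2) right_index[OF t] that by blast
    then show "\<exists>K. \<forall>k\<ge>K. \<forall>l\<ge>K. dist (x (right_index t k)) (x (right_index t l)) < \<epsilon>"
      using \<open>0 < \<epsilon>\<close> by (intro exI[of _ K]) (force simp: dist_real_def)
  qed
  then show ?thesis
    using t by (auto simp: trace_path_def convergent_LIMSEQ_iff Cauchy_convergent_iff)
qed

text \<open>Carries estimates from coordinates to decoded values. The case \<open>t = a\<close> is
  included, because decoding uses only times strictly after \<open>t\<close>.\<close>

lemma trace_path_near:
  assumes x: "cadlag_trace x" and t: "0 \<le> t" "t < T" "a \<le> t" "t < b"
    and c: "\<And>i. a < e i \<Longrightarrow> e i < b \<Longrightarrow> \<bar>x i - c\<bar> \<le> \<epsilon>"
  shows "\<bar>trace_path x t - c\<bar> \<le> \<epsilon>"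
proof (rule LIMSEQ_le_const2)
  show "(\<lambda>k. \<bar>x (right_index t k) - c\<bar>) \<longlonglongrightarrow> \<bar>trace_path x t - c\<bar>"
    by (intro tendsto_intros trace_path_LIMSEQ x t)
  have "eventually (\<lambda>k. e (right_index t k) < b) sequentially"
    using right_index_LIMSEQ[OF t(1,2)] t by (intro order_tendstoD) auto
  then obtain K where "\<And>k. k \<ge> K \<Longrightarrow> e (right_index t k) < b"
    by (auto simp: eventually_sequentially)
  then show "\<exists>K. \<forall>k\<ge>K. \<bar>x (right_index t k) - c\<bar> \<le> \<epsilon>"
    using right_index(1)[OF t(1,2)] t by (intro exI[of _ K]) (auto intro!: c intro: le_less_trans)
qed

lemma trace_path_cadlag:
  assumes x: "cadlag_trace x"
  shows "trace_path x \<in> cadlag_space T"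
proof -
  have "(trace_path x \<longlongrightarrow> trace_path x t) (at_right t)" if t: "0 \<le> t" "t < T" for t
  proof (rule tendstoI)
    fix \<epsilon> :: real assume \<epsilon>: "0 < \<epsilon>"
    then obtain \<delta> where \<delta>: "\<delta> > 0" "\<And>i j. t < e i \<Longrightarrow> e i < t + \<delta> \<Longrightarrow> t < e j \<Longrightarrow> e j < t + \<delta> \<Longrightarrow> \<bar>x i - x j\<bar> \<le> \<epsilon> / 2"
      using cadlag_trace_Cauchy_right[OF x, of "\<epsilon> / 2" t] by auto
    \<comment> \<open>The estimate between coordinates is transferred in two rounds: first one
      coordinate is replaced by the value at \<open>t\<close>, then the other by the value at
      \<open>s\<close>.\<close>
    have 1: "\<bar>x i - trace_path x t\<bar> \<le> \<epsilon> / 2" if "t < e i" "e i < t + \<delta>" for i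
      using trace_path_near[OF x t order_refl, of "t + \<delta>" "x i" "\<epsilon> / 2"] \<delta> that
      by (auto simp: abs_minus_commute)
    have "\<bar>trace_path x s - trace_path x t\<bar> \<le> \<epsilon> / 2" if "t < s" "s < min T (t + \<delta>)" for s
      using that t by (intro trace_path_near[OF x, where a=t and b="t + \<delta>"] 1) auto
    then show "eventually (\<lambda>s. dist (trace_path x s) (trace_path x t) < \<epsilon>) (at_right t)"
      unfolding eventually_at_right_field using \<delta> t \<epsilon>
      by (intro exI[of _ "min T (t + \<delta>)"]) (force simp: dist_real_def)
  qed
  moreover have "\<exists>l. (trace_path x \<longlongrightarrow> l) (at_left t)" if t: "0 < t" "t \<le> T" for t
  proof -
    have osc: "\<exists>a\<ge>0. a < t \<and> (\<forall>s s'. a < s \<and> s < t \<and> a < s' \<and> s' < t \<longrightarrow> \<bar>trace_path x s - trace_path x s'\<bar> \<le> \<epsilon>)"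
      if \<epsilon>: "0 < \<epsilon>" for \<epsilon>
    proof -
      obtain \<delta> where \<delta>: "\<delta> > 0" "\<And>i j. t - \<delta> < e i \<Longrightarrow> e i < t \<Longrightarrow> t - \<delta> < e j \<Longrightarrow> e j < t \<Longrightarrow> \<bar>x i - x j\<bar> \<le> \<epsilon>"
        using cadlag_trace_Cauchy_left[OF x \<epsilon>, of t] by auto
      have "\<bar>trace_path x s - trace_path x s'\<bar> \<le> \<epsilon>"
        if s: "max 0 (t - \<delta>) < s" "s < t" "max 0 (t - \<delta>) < s'" "s' < t" for s s'
      proof (rule trace_path_near[OF x, where a="t-\<delta>" and b=t])
        fix i assume i: "t - \<delta> < e i" "e i < t"
        have "\<bar>trace_path x s' - x i\<bar> \<le> \<epsilon>"
          using s t i \<delta> by (intro trace_path_near[OF x, where a="t-\<delta>" and b=t]) auto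
        then show "\<bar>x i - trace_path x s'\<bar> \<le> \<epsilon>" by linarith
      qed (use s t in auto)
      then show ?thesis using t \<delta> by (intro exI[of _ "max 0 (t - \<delta>)"]) auto
    qed
    \<comment> \<open>A sequence in the open interval from \<open>0\<close> to \<open>t\<close> that
      increases to \<open>t\<close>; its image is Cauchy and supplies the candidate left
      limit.\<close>
    define u where "u k = t - t / real (Suc (Suc k))" for k
    have u: "u k < t" for k using t by (simp add: u_def)
    have "(\<lambda>k. t / real (Suc (Suc k))) \<longlonglongrightarrow> 0"
      using LIMSEQ_ignore_initial_segment[OF lim_const_over_n[of t], of 2] by simp
    then have ulim: "u \<longlonglongrightarrow> t" unfolding u_def using tendsto_diff[OF tendsto_const[of t]] by force
    have uev: "\<exists>K. \<forall>k\<ge>K. a < u k" if "a < t" for a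
      using order_tendstoD(1)[OF ulim that] by (simp add: eventually_sequentially)
    have "Cauchy (\<lambda>k. trace_path x (u k))"
    proof (rule metric_CauchyI)
      fix \<epsilon> :: real assume "0 < \<epsilon>"
      then obtain a where a: "a < t" "\<forall>s s'. a < s \<and> s < t \<and> a < s' \<and> s' < t \<longrightarrow> \<bar>trace_path x s - trace_path x s'\<bar> \<le> \<epsilon> / 2"
        using osc[of "\<epsilon> / 2"] by auto
      then obtain K where "\<forall>k\<ge>K. a < u k" using uev by blast
      then have "\<bar>trace_path x (u k) - trace_path x (u l)\<bar> \<le> \<epsilon> / 2" if "k \<ge> K" "l \<ge> K" for k l
        using a(2) u that by blast
      then show "\<exists>K. \<forall>k\<ge>K. \<forall>l\<ge>K. dist (trace_path x (u k)) (trace_path x (u l)) < \<epsilon>"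
        using \<open>0 < \<epsilon>\<close> by (intro exI[of _ K]) (force simp: dist_real_def)
    qed
    then obtain l where l: "(\<lambda>k. trace_path x (u k)) \<longlonglongrightarrow> l"
      by (auto simp: Cauchy_convergent_iff convergent_def)
    have "(trace_path x \<longlongrightarrow> l) (at_left t)"
    proof (rule tendstoI)
      fix \<epsilon> :: real assume "0 < \<epsilon>"
      then obtain a where a: "a < t" "\<forall>s s'. a < s \<and> s < t \<and> a < s' \<and> s' < t \<longrightarrow> \<bar>trace_path x s - trace_path x s'\<bar> \<le> \<epsilon> / 2"
        using osc[of "\<epsilon> / 2"] by auto
      then obtain K where K: "\<forall>k\<ge>K. a < u k" using uev by blast
      have "\<bar>trace_path x s - l\<bar> \<le> \<epsilon> / 2" if "a < s" "s < t" for s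
      proof (rule LIMSEQ_le_const2)
        show "(\<lambda>k. \<bar>trace_path x s - trace_path x (u k)\<bar>) \<longlonglongrightarrow> \<bar>trace_path x s - l\<bar>"
          by (intro tendsto_intros l)
        show "\<exists>N. \<forall>k\<ge>N. \<bar>trace_path x s - trace_path x (u k)\<bar> \<le> \<epsilon> / 2"
          using a(2) K u that by blast
      qed
      then show "eventually (\<lambda>s. dist (trace_path x s) l < \<epsilon>) (at_left t)"
        unfolding eventually_at_left_field using a \<open>0 < \<epsilon>\<close>
        by (intro exI[of _ a]) (force simp: dist_real_def)
    qed
    then show ?thesis ..
  qed
  ultimately show ?thesis
    by (auto simp: cadlag_space_def cadlag_on_def trace_path_def)
qed

lemma trace_path_mono:
  assumes "cadlag_trace x" "cadlag_trace y" "x \<le> y"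
  shows "path_le T (trace_path x) (trace_path y)"
  unfolding path_le_def
proof
  fix t assume t: "t \<in> {0..T}"
  show "trace_path x t \<le> trace_path y t"
  proof (cases "t = T")
    case True
    then show ?thesis using t assms by (simp add: trace_path_def le_funD)
  next
    case False
    then show ?thesis
      using t assms by (intro LIMSEQ_le[OF trace_path_LIMSEQ[of x t] trace_path_LIMSEQ[of y t]]) (auto simp: le_funD)
  qed
qed

lemma trace_path_measurable:
  "trace_path \<in> measurable (restrict_space borel {x. cadlag_trace x}) (cadlag_algebra T)"
  unfolding cadlag_algebra_def
proof (rule measurable_measure_of)
  show "{{\<alpha> \<in> cadlag_space T. \<alpha> t \<in> B} |t B. t \<in> {0..T} \<and> B \<in> sets borel} \<subseteq> Pow (cadlag_space T)"
    by auto
  show "trace_path \<in> space (restrict_space borel {x. cadlag_trace x}) \<rightarrow> cadlag_space T"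
    using trace_path_cadlag by (auto simp: space_restrict_space)
  fix A assume "A \<in> {{\<alpha> \<in> cadlag_space T. \<alpha> t \<in> B} |t B. t \<in> {0..T} \<and> B \<in> sets borel}"
  then obtain t B where A: "A = {\<alpha> \<in> cadlag_space T. \<alpha> t \<in> B}" "t \<in> {0..T}" "B \<in> sets borel" by blast
  have "(\<lambda>x. trace_path x t) \<in> borel_measurable borel"
  proof (cases "t = T")
    case True
    then show ?thesis using A by (simp add: trace_path_def measurable_product_coordinates)
  next
    case False
    \<comment> \<open>\<open>lim\<close> takes one fixed value wherever the sequence diverges, so
      this is measurable on all sequences; being a trace matters only for the values to be cadlag
      paths.\<close>
    have "(\<lambda>x::nat\<Rightarrow>real. lim (\<lambda>k. x (right_index t k))) \<in> borel_measurable borel"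
      by (intro borel_measurable_lim_metric measurable_product_coordinates)
    then show ?thesis using A False by (simp add: trace_path_def)
  qed
  then have "(\<lambda>x. trace_path x t) -` B \<inter> {x. cadlag_trace x} \<in> sets (restrict_space borel {x. cadlag_trace x})"
    using A measurable_sets[of "\<lambda>x. trace_path x t" borel borel B] by (auto simp: sets_restrict_space)
  also have "(\<lambda>x. trace_path x t) -` B \<inter> {x. cadlag_trace x} =
      trace_path -` A \<inter> space (restrict_space borel {x. cadlag_trace x})"
    using A trace_path_cadlag by (auto simp: space_restrict_space)
  finally show "trace_path -` A \<inter> space (restrict_space borel {x. cadlag_trace x}) \<in> sets (restrict_space borel {x. cadlag_trace x})" .
qed

end

lemma dense_times_exists:
  assumes "0 < T"
  shows "\<exists>e k. dense_times T e k"
proof -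
  obtain Q :: "real set" where Q: "countable Q" "\<And>Y. open Y \<Longrightarrow> Y \<noteq> {} \<Longrightarrow> \<exists>d\<in>Q. d \<in> Y"
    using countable_dense_setE[where 'a=real] by metis
  define S where "S = insert T (Q \<inter> {0..T})"
  have S: "countable S" "S \<noteq> {}" using Q by (auto simp: S_def)
  define e where "e = from_nat_into S"
  have e: "range e = S" using S by (simp add: e_def range_from_nat_into)
  then obtain k where k: "e k = T" by (metis S_def insertI1 rangeE)
  have "dense_times T e k"
  proof
    show "e i \<in> {0..T}" for i using rangeI[of e i] e assms by (auto simp: S_def)
    fix a b :: real assume ab: "0 \<le> a" "a < b" "b \<le> T"
    then obtain d where "d \<in> Q" "a < d" "d < b" using Q(2)[of "{a<..<b}"] by auto
    then have "d \<in> range e" using ab by (auto simp: e S_def)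
    then show "\<exists>i. a < e i \<and> e i < b" using \<open>a < d\<close> \<open>d < b\<close> by auto
  qed (use assms k in auto)
  then show ?thesis by blast
qed

section \<open>Transfer from sequences to functionals of the path\<close>

context dense_times
begin

text \<open>The default \<open>0\<close> outside the traces may destroy monotonicity on the whole
  sequence space, so the correlation inequality for sequences asks for it only on a set of
  probability one.\<close>

definition trace_functional :: "((real \<Rightarrow> real) \<Rightarrow> real) \<Rightarrow> (nat \<Rightarrow> real) \<Rightarrow> real" where
  "trace_functional F x = (if cadlag_trace x then F (trace_path x) else 0)"

lemma trace_functional_measurable:
  assumes "F \<in> borel_measurable (cadlag_algebra T)"
  shows "trace_functional F \<in> borel_measurable borel"
proof -
  have "(\<lambda>x. F (trace_path x)) \<in> borel_measurable (restrict_space borel {x. cadlag_trace x})"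
    by (rule measurable_compose[OF trace_path_measurable assms])
  then show ?thesis
    unfolding trace_functional_def[abs_def]
    by (subst measurable_If_restrict_space_iff) (auto simp: borel_cadlag_trace)
qed

lemma trace_functional_bounded:
  assumes "bounded (F ` cadlag_space T)"
  shows "bounded (range (trace_functional F))"
proof (rule bounded_subset)
  show "bounded (insert 0 (F ` cadlag_space T))" using assms by simp
  show "range (trace_functional F) \<subseteq> insert 0 (F ` cadlag_space T)"
    unfolding trace_functional_def using trace_path_cadlag by (intro image_subsetI) simp
qed

lemma trace_functional_mono_on:
  assumes "monotone_on (cadlag_space T) (path_le T) (\<le>) F"
  shows "mono_on {x. cadlag_trace x} (trace_functional F)"
proof (rule mono_onI)
  fix x y assume "x \<in> {x. cadlag_trace x}" "y \<in> {x. cadlag_trace x}" "x \<le> y"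
  moreover from this have "F (trace_path x) \<le> F (trace_path y)"
    by (intro monotone_onD[OF assms] trace_path_cadlag trace_path_mono) simp_all
  ultimately show "trace_functional F x \<le> trace_functional F y"
    by (simp add: trace_functional_def)
qed

lemma trace_functional_sample_path:
  assumes "cadlag_process M T X" "\<omega> \<in> space M"
  shows "cadlag_trace (\<lambda>n. X (e n) \<omega>)"
    and "trace_functional F (\<lambda>n. X (e n) \<omega>) = F (sample_path T X \<omega>)"
proof -
  have sp: "sample_path T X \<omega> \<in> cadlag_space T"
    using measurable_space[OF sample_path_measurable[OF assms(1)] assms(2)]
    by (simp add: cadlag_algebra_def space_measure_of_conv)
  have eq: "(\<lambda>n. X (e n) \<omega>) = (\<lambda>n. sample_path T X \<omega> (e n))"
    using e_range by (simp add: sample_path_def)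
  show "cadlag_trace (\<lambda>n. X (e n) \<omega>)"
    unfolding eq using sp by (intro cadlag_trace_compose) (simp add: cadlag_space_def)
  then show "trace_functional F (\<lambda>n. X (e n) \<omega>) = F (sample_path T X \<omega>)"
    unfolding trace_functional_def eq using trace_path_compose[OF sp] by simp
qed

lemma monotone_functionals_correlation:
  fixes M :: "'a measure" and F G :: "(real \<Rightarrow> real) \<Rightarrow> real"
  assumes M: "prob_space M" and X: "cadlag_process M T X" "independent_increments M T X"
    and F: "F \<in> borel_measurable (cadlag_algebra T)" "bounded (F ` cadlag_space T)"
      "monotone_on (cadlag_space T) (path_le T) (\<le>) F"
    and G: "G \<in> borel_measurable (cadlag_algebra T)" "bounded (G ` cadlag_space T)"
      "monotone_on (cadlag_space T) (path_le T) (\<le>) G"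
  shows "(\<integral>\<omega>. F (sample_path T X \<omega>) \<partial>M) * (\<integral>\<omega>. G (sample_path T X \<omega>) \<partial>M)
    \<le> (\<integral>\<omega>. F (sample_path T X \<omega>) * G (sample_path T X \<omega>) \<partial>M)"
proof -
  interpret prob_space M by fact
  let ?\<phi> = "\<lambda>\<omega> n. X (e n) \<omega>"
  have \<phi> [measurable]: "?\<phi> \<in> borel_measurable M"
    using X(1) e_range by (intro measurable_coordinatewise_then_product) (auto simp: cadlag_process_def)
  \<comment> \<open>Freezing coordinates after \<open>n\<close> leaves only the times
    \<open>e 0\<close>, ..., \<open>e n\<close>, so the finite-dimensional result applies.\<close>
  have fd: "associated (distr (distr M borel ?\<phi>) borel (\<lambda>x i. x (min i n)))" for n
  proof -
    have "(\<lambda>(x::nat\<Rightarrow>real) i. x (min i n)) \<in> borel_measurable borel"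
      by (intro measurable_coordinatewise_then_product measurable_product_coordinates)
    then have "distr (distr M borel ?\<phi>) borel (\<lambda>x i. x (min i n)) = distr M borel (\<lambda>\<omega> i. X (e (min i n)) \<omega>)"
      by (subst distr_distr) (auto simp: comp_def)
    moreover have "associated (distr M borel (\<lambda>\<omega> i. X (e (min i n)) \<omega>))"
    proof (rule associated_finite_dim[OF M X])
      show "finite (e ` {..n})" "e ` {..n} \<subseteq> {0..T}" "range (\<lambda>i. e (min i n)) \<subseteq> e ` {..n}"
        by (blast intro: finite_imageI finite_atMost e_range min.cobounded2 atMost_iff[THEN iffD2])+
    qed
    ultimately show ?thesis by simp
  qed
  have one: "measure (distr M borel ?\<phi>) {x. cadlag_trace x} = 1"
  proof -
    have "?\<phi> -` {x. cadlag_trace x} \<inter> space M = space M"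
      using trace_functional_sample_path(1)[OF X(1)] by auto
    then show ?thesis by (simp add: measure_distr borel_cadlag_trace prob_space)
  qed
  note meas = trace_functional_measurable[OF F(1)] trace_functional_measurable[OF G(1)]
  have eq: "(\<integral>x. trace_functional F x \<partial>distr M borel ?\<phi>) = (\<integral>\<omega>. F (sample_path T X \<omega>) \<partial>M)"
    if "F \<in> borel_measurable (cadlag_algebra T)" for F
    unfolding integral_distr[OF \<phi> trace_functional_measurable[OF that]]
    by (rule Bochner_Integration.integral_cong) (simp_all add: trace_functional_sample_path(2)[OF X(1)])
  have eq': "(\<integral>x. trace_functional F x * trace_functional G x \<partial>distr M borel ?\<phi>) =
      (\<integral>\<omega>. F (sample_path T X \<omega>) * G (sample_path T X \<omega>) \<partial>M)"
    unfolding integral_distr[OF \<phi> borel_measurable_times[OF meas]]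
    by (rule Bochner_Integration.integral_cong) (simp_all add: trace_functional_sample_path(2)[OF X(1)])
  have "(\<integral>x. trace_functional F x \<partial>distr M borel ?\<phi>) * (\<integral>x. trace_functional G x \<partial>distr M borel ?\<phi>)
      \<le> (\<integral>x. trace_functional F x * trace_functional G x \<partial>distr M borel ?\<phi>)"
    by (rule monotone_positive_correlation[OF prob_space_distr[OF \<phi>] sets_distr fd borel_cadlag_trace one,
      OF meas(1) trace_functional_bounded[OF F(2)] trace_functional_mono_on[OF F(3)]
         meas(2) trace_functional_bounded[OF G(2)] trace_functional_mono_on[OF G(3)]])
  then show ?thesis
    unfolding eq[OF F(1)] eq[OF G(1)] eq' .
qed

end

theorem proposition5p2:
  fixes M :: "'a measure" and T :: real and X :: "real \<Rightarrow> 'a \<Rightarrow> real"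
  assumes "prob_space M"
    and "0 < T"
    and "cadlag_process M T X"
    and "independent_increments M T X"
  shows "comonotony_principle M T X"
proof -
  obtain e k where "dense_times T e k"
    using dense_times_exists[OF \<open>0 < T\<close>] by blast
  then interpret dense_times T e k .
  note corr = monotone_functionals_correlation[OF assms(1,3,4)]
  show ?thesis
    unfolding comonotony_principle_def
  proof (intro allI impI, elim conjE)
    fix F G
    assume F: "F \<in> borel_measurable (cadlag_algebra T)" "bounded (F ` cadlag_space T)"
      and G: "G \<in> borel_measurable (cadlag_algebra T)" "bounded (G ` cadlag_space T)"
      and "comonotone T F G"
    then consider
      "monotone_on (cadlag_space T) (path_le T) (\<le>) F" "monotone_on (cadlag_space T) (path_le T) (\<le>) G"
      | "monotone_on (cadlag_space T) (path_le T) (\<ge>) F" "monotone_on (cadlag_space T) (path_le T) (\<ge>) G"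
      unfolding comonotone_def by blast
    then show "(\<integral>\<omega>. F (sample_path T X \<omega>) * G (sample_path T X \<omega>) \<partial>M) \<ge>
          (\<integral>\<omega>. F (sample_path T X \<omega>) \<partial>M) * (\<integral>\<omega>. G (sample_path T X \<omega>) \<partial>M)"
    proof cases
      case 1
      then show ?thesis using F G by (intro corr) auto
    next
      case 2
      \<comment> \<open>Negating both functionals turns non-increasing into non-decreasing and
        leaves both products unchanged.\<close>
      have "bounded ((\<lambda>\<alpha>. - F \<alpha>) ` cadlag_space T)" "bounded ((\<lambda>\<alpha>. - G \<alpha>) ` cadlag_space T)"
        using F(2) G(2) bounded_uminus[of "F ` cadlag_space T"] bounded_uminus[of "G ` cadlag_space T"]
        by (simp_all only: image_image)
      moreover have "monotone_on (cadlag_space T) (path_le T) (\<le>) (\<lambda>\<alpha>. - F \<alpha>)"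
        "monotone_on (cadlag_space T) (path_le T) (\<le>) (\<lambda>\<alpha>. - G \<alpha>)"
        using 2 by (simp_all add: monotone_on_def)
      ultimately have "(\<integral>\<omega>. - F (sample_path T X \<omega>) \<partial>M) * (\<integral>\<omega>. - G (sample_path T X \<omega>) \<partial>M)
          \<le> (\<integral>\<omega>. - F (sample_path T X \<omega>) * - G (sample_path T X \<omega>) \<partial>M)"
        using F(1) G(1) by (intro corr borel_measurable_uminus)
      then show ?thesis by simp
    qed
  qed
qed

end
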